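(* Fix a natural number $n$ and work in ${}^{\omega_n}\omega$. Let $k\geq1$. If $\Diamond(S_i^{i+1})$ holds for every $i<k$, then $T(k)$ holds, where $T(k)$ is the statement: for every strong $\aleph_k$-unbounded pair $(P,Q)$, every $\aleph_k$-spine filtration $(\langle P_\alpha\mid\alpha<\omega_k\rangle,Q')$ of it, and every set $E$ that is $k$-twistable for $(\langle P_\alpha\mid\alpha<\omega_k\rangle,Q')$, there exists a $k$-coherent family $\Phi$ indexed by $P^{(k)}$ such that $(\Phi\restriction Q'^{(k)})\restriction\restriction E$ is nontrivial.
   Context: $I(f)=\{(i,j)\in\omega_n\times\omega\mid j\leq f(i)\}$; $\leq$ pointwise order, $\leq^*$ eventual domination; $\varphi=^*\psi$ means the functions differ at finitely many points of their common domain, and sums/comparisons of functions are taken on the intersection of domains. For a quasi-ordered set $X$ (here ordered by $\leq^*$) and $m\geq1$, $X^{(m)}$ is the set of tuples $\vec f=(f_0,\dots,f_{m-1})$ with $f_i\leq^* f_j$ for $i\leq j$, and $\vec f^i$ is $\vec f$ with its $i$-th entry removed. An $m$-family on $X$ (with domain $D\subseteq\omega_n\times\omega$) is $\Phi=\langle\varphi_{\vec f}:I(f_0)\cap D\to\mathbb{Z}\mid\vec f\in X^{(m)}\rangle$. It is $1$-coherent if $\varphi_f=^*\varphi_g$ for $f\leq^*g$; for $m\geq2$ it is $m$-coherent if $\sum_{i=0}^m(-1)^i\varphi_{\vec f^i}=^*0$ for all $\vec f\in X^{(m+1)}$. A $1$-family is trivial if some $\varphi:D\to\mathbb{Z}$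 has $\varphi_f=^*\varphi\restriction(I(f)\cap D)$ for all $f$; for $m\geq2$ an $m$-family is trivial if there is an $(m-1)$-family $\Psi=\langle\psi_{\vec g}:I(g_0)\cap D\to\mathbb{Z}\rangle$ with $\sum_{i=0}^{m-1}(-1)^i\psi_{\vec f^i}=^*\varphi_{\vec f}$ for all $\vec f\in X^{(m)}$. $\Phi\restriction Y^{(m)}$ restricts the indices to $Y$; $\Phi\restriction\restriction E$ restricts each function to its domain intersected with $E$. $S_i^{i+1}=\{\alpha<\omega_{i+1}\mid\mathrm{cf}(\alpha)=\omega_i\}$; $\Diamond(S)$ for stationary $S\subseteq\kappa$ asserts there is $\langle A_\alpha\subseteq\alpha\mid\alpha\in S\rangle$ with $\{\alpha\in S\mid A\cap\alpha=A_\alpha\}$ stationary for each $A\subseteq\kappa$. Unbounded pairs (w.r.t. $\leq^*$): $(P,Q)$ with $Q\subseteq P$ is $\kappa$-unbounded if $P$ is directed, $Q$ is unbounded in $P$, and there is a strictly increasing enumeration (a $\kappa$-spine) of a cofinal subset $R$ of $Q$, with $\mathrm{cf}(P)=\mathrm{cf}(Q)=\mathrm{cf}(R)=\kappa$; it is strong if $Q$ is well-ordered and $\leq,\leq^*$ coincide on $Q$. A $\kappa$-spine filtration is a continuous increasing filtration $P=\bigcup_{\alpha<\kappa}P_\alpha$ by downward closed $P_\alpha$ with $\mathrm{cf}(P_\alpha)<\kappa$, together with a spine $Q'=\langle Q'(\alpha)\mid\alpha<\kappa\rangle$ in $Q$ with $\mathrm{otp}(Q'\cap P_\alpha)=\alpha$;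 $Q'\restriction\alpha=\{Q'(\beta)\mid\beta<\alpha\}$. Twistable sets: if $P$ has cofinality $\leq\aleph_0$, $E$ is $0$-twistable for $(P,Q)$ if $|E|=\aleph_0$ and $E\cap I(f)$ is finite for all $f\in P$. For $j\geq0$ and an $\aleph_{j+1}$-spine filtration $(\langle P_\alpha\rangle,Q')$ of a strong $\aleph_{j+1}$-unbounded pair, $E$ is $(j+1)$-twistable for it if $E=\bigcup_{\alpha\in\{0\}\cup S_j^{j+1}}E_\alpha$ with $|E_0|\leq\aleph_j$, $E_0\subseteq I(Q'(0))$, and for all $\alpha\in S_j^{j+1}$: $E_\alpha\subseteq I(Q'(\alpha))$, $E_\alpha$ is $j$-twistable for $(P_\alpha,Q'\restriction\alpha)$, and if $\alpha=\sup(\alpha\cap S_j^{j+1})$ then $E_\alpha\subseteq\bigcup_{\beta\in(\{0\}\cup S_j^{j+1})\cap\alpha}E_\beta$; $E$ is $(j+1)$-twistable for a strong pair if it is so for some spine filtration of it. *)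

theory Defs
  imports Complex_Main
begin

unbundle cardinal_syntax

text \<open>
  Ordinals are the elements of an arbitrary well-ordered type, an ordinal \<open>\<alpha>\<close> is identified with the
  initial segment \<open>{..<\<alpha>}\<close>, and \<open>omega i\<close> is the initial segment \<open>\<omega>\<^sub>i\<close> (so \<open>\<omega>\<^bsub>i+1\<^esub>\<close> consists of the
  ordinals of cardinality at most \<open>\<aleph>\<^sub>i\<close>), with \<open>|omega i|\<close> in the role of \<open>\<aleph>\<^sub>i\<close>.
  No closed HOL type provably contains all the \<open>\<omega>\<^sub>i\<close>; \<open>has_omega TYPE('o) k\<close> says that \<open>'o\<close> is long
  enough for \<open>omega 0, \<dots>, omega k\<close> to be the true \<open>\<omega>\<^sub>0, \<dots>, \<omega>\<^sub>k\<close>.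
\<close>

primrec omega :: "nat \<Rightarrow> 'o::wellorder set" where
  "omega 0 = {\<alpha>. finite {..<\<alpha>}}"
| "omega (Suc i) = {\<alpha>. |{..<\<alpha>}| \<le>o |omega i :: 'o set|}"

definition has_omega :: "'o::wellorder itself \<Rightarrow> nat \<Rightarrow> bool" where
  "has_omega _ k \<longleftrightarrow> infinite (omega 0 :: 'o set) \<and>
     (\<forall>i<k. |omega i :: 'o set| <o |omega (Suc i) :: 'o set| )"

definition ord_zero :: "'o::wellorder" where
  "ord_zero = (LEAST \<alpha>. True)"

definition limit_ord :: "'o::wellorder \<Rightarrow> bool" where
  "limit_ord \<delta> \<longleftrightarrow> \<delta> \<noteq> ord_zero \<and> (\<forall>\<beta><\<delta>. \<exists>\<gamma>. \<beta> < \<gamma> \<and> \<gamma> < \<delta>)"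

definition cofinal_in :: "('a \<Rightarrow> 'a \<Rightarrow> bool) \<Rightarrow> 'a set \<Rightarrow> 'a set \<Rightarrow> bool" where
  "cofinal_in le X C \<longleftrightarrow> C \<subseteq> X \<and> (\<forall>x\<in>X. \<exists>c\<in>C. le x c)"

definition cf_eq :: "('a \<Rightarrow> 'a \<Rightarrow> bool) \<Rightarrow> 'a set \<Rightarrow> 'o set \<Rightarrow> bool" where
  "cf_eq le X \<kappa> \<longleftrightarrow> (\<exists>C. cofinal_in le X C \<and> |C| =o |\<kappa>| ) \<and>
     (\<forall>C. cofinal_in le X C \<longrightarrow> |\<kappa>| \<le>o |C| )"

definition cf_less :: "('a \<Rightarrow> 'a \<Rightarrow> bool) \<Rightarrow> 'a set \<Rightarrow> 'o set \<Rightarrow> bool" where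
  "cf_less le X \<kappa> \<longleftrightarrow> (\<exists>C. cofinal_in le X C \<and> |C| <o |\<kappa>| )"

text \<open>Below, \<open>\<kappa>\<close> is meant to be an initial segment \<open>omega i\<close>.\<close>

definition club_in :: "'o::wellorder set \<Rightarrow> 'o set \<Rightarrow> bool" where
  "club_in \<kappa> C \<longleftrightarrow> C \<subseteq> \<kappa> \<and> (\<forall>\<alpha>\<in>\<kappa>. \<exists>\<gamma>\<in>C. \<alpha> < \<gamma>) \<and>
     (\<forall>\<delta>\<in>\<kappa>. limit_ord \<delta> \<and> (\<forall>\<beta><\<delta>. \<exists>\<gamma>\<in>C. \<beta> < \<gamma> \<and> \<gamma> < \<delta>) \<longrightarrow> \<delta> \<in> C)"

definition stationary_in :: "'o::wellorder set \<Rightarrow> 'o set \<Rightarrow> bool" where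
  "stationary_in \<kappa> S \<longleftrightarrow> S \<subseteq> \<kappa> \<and> (\<forall>C. club_in \<kappa> C \<longrightarrow> S \<inter> C \<noteq> {})"

definition diamond :: "'o::wellorder set \<Rightarrow> 'o set \<Rightarrow> bool" where
  "diamond \<kappa> S \<longleftrightarrow> (\<exists>A :: 'o \<Rightarrow> 'o set. (\<forall>\<alpha>\<in>S. A \<alpha> \<subseteq> {..<\<alpha>}) \<and>
     (\<forall>X\<subseteq>\<kappa>. stationary_in \<kappa> {\<alpha>\<in>S. X \<inter> {..<\<alpha>} = A \<alpha>}))"

definition cof_set :: "nat \<Rightarrow> 'o::wellorder set" where
  \<comment> \<open>the set \<open>S\<close> with lower index \<open>i\<close> and upper index \<open>i + 1\<close>\<close>
  "cof_set i = {\<alpha> \<in> omega (Suc i). cf_eq (\<le>) {..<\<alpha>} (omega i :: 'o set)}"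

text \<open>The type \<open>'w\<close> plays the role of \<open>\<omega>\<^sub>n\<close>.\<close>

definition le_star :: "('w \<Rightarrow> nat) \<Rightarrow> ('w \<Rightarrow> nat) \<Rightarrow> bool"  (infix \<open>\<le>\<^sup>*\<close> 50) where
  "f \<le>\<^sup>* g \<longleftrightarrow> (\<forall>\<^sub>F i in cofinite. f i \<le> g i)"

definition region :: "('w \<Rightarrow> nat) \<Rightarrow> ('w \<times> nat) set" where
  "region f = {(i, j). j \<le> f i}"

text \<open>
  An \<open>m\<close>-family on \<open>X\<close> with domain \<open>D\<close> is a map \<open>\<Phi>\<close> assigning total functions to lists; only the
  lists in \<open>tuples X m\<close> and, for each such list \<open>fs\<close>, only the values on \<open>fdom D fs\<close> are ever
  inspected.  Hence restricting the indices or the domain of a family amounts to passing a smaller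
  \<open>X\<close> or \<open>D\<close>.
\<close>

type_synonym 'w family = "('w \<Rightarrow> nat) list \<Rightarrow> 'w \<times> nat \<Rightarrow> int"

definition tuples :: "('w \<Rightarrow> nat) set \<Rightarrow> nat \<Rightarrow> ('w \<Rightarrow> nat) list set" where
  "tuples X m = {fs. length fs = m \<and> set fs \<subseteq> X \<and> (\<forall>j<m. \<forall>i\<le>j. fs ! i \<le>\<^sup>* fs ! j)}"

definition omit :: "nat \<Rightarrow> 'a list \<Rightarrow> 'a list" where
  "omit i xs = take i xs @ drop (Suc i) xs"

definition fdom :: "('w \<times> nat) set \<Rightarrow> ('w \<Rightarrow> nat) list \<Rightarrow> ('w \<times> nat) set" where
  "fdom D fs = region (hd fs) \<inter> D"

definition eq_star_on :: "'a set \<Rightarrow> ('a \<Rightarrow> int) \<Rightarrow> ('a \<Rightarrow> int) \<Rightarrow> bool" where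
  "eq_star_on A \<phi> \<psi> \<longleftrightarrow> finite {x\<in>A. \<phi> x \<noteq> \<psi> x}"

definition coherent ::
  "('w \<times> nat) set \<Rightarrow> ('w \<Rightarrow> nat) set \<Rightarrow> nat \<Rightarrow> 'w family \<Rightarrow> bool" where
  "coherent D X m \<Phi> \<longleftrightarrow>
     (if m = 1
      then \<forall>f\<in>X. \<forall>g\<in>X. f \<le>\<^sup>* g \<longrightarrow> eq_star_on (fdom D [f] \<inter> fdom D [g]) (\<Phi> [f]) (\<Phi> [g])
      else \<forall>fs\<in>tuples X (m + 1).
             eq_star_on (\<Inter>i\<le>m. fdom D (omit i fs))
               (\<lambda>x. \<Sum>i\<le>m. (- 1) ^ i * \<Phi> (omit i fs) x) (\<lambda>x. 0))"

definition trivial ::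
  "('w \<times> nat) set \<Rightarrow> ('w \<Rightarrow> nat) set \<Rightarrow> nat \<Rightarrow> 'w family \<Rightarrow> bool" where
  "trivial D X m \<Phi> \<longleftrightarrow>
     (if m = 1
      then \<exists>\<phi> :: 'w \<times> nat \<Rightarrow> int. \<forall>f\<in>X. eq_star_on (fdom D [f]) (\<Phi> [f]) \<phi>
      else \<exists>\<Psi> :: 'w family. \<forall>fs\<in>tuples X m.
             eq_star_on ((\<Inter>i<m. fdom D (omit i fs)) \<inter> fdom D fs)
               (\<lambda>x. \<Sum>i<m. (- 1) ^ i * \<Psi> (omit i fs) x) (\<Phi> fs))"

definition directed_star :: "('w \<Rightarrow> nat) set \<Rightarrow> bool" where
  "directed_star P \<longleftrightarrow> P \<noteq> {} \<and> (\<forall>f\<in>P. \<forall>g\<in>P. \<exists>h\<in>P. f \<le>\<^sup>* h \<and> g \<le>\<^sup>* h)"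

definition spine :: "'o::wellorder set \<Rightarrow> ('w \<Rightarrow> nat) set \<Rightarrow> ('o \<Rightarrow> 'w \<Rightarrow> nat) \<Rightarrow> bool" where
  "spine \<kappa> Q r \<longleftrightarrow> cofinal_in (\<le>\<^sup>*) Q (r ` \<kappa>) \<and>
     (\<forall>\<alpha>\<in>\<kappa>. \<forall>\<beta>\<in>\<kappa>. \<alpha> < \<beta> \<longrightarrow> r \<alpha> \<le>\<^sup>* r \<beta> \<and> \<not> r \<beta> \<le>\<^sup>* r \<alpha>)"

definition unbounded_pair ::
  "'o::wellorder set \<Rightarrow> ('w \<Rightarrow> nat) set \<Rightarrow> ('w \<Rightarrow> nat) set \<Rightarrow> bool" where
  "unbounded_pair \<kappa> P Q \<longleftrightarrow> Q \<subseteq> P \<and> directed_star P \<and> \<not> (\<exists>p\<in>P. \<forall>q\<in>Q. q \<le>\<^sup>* p) \<and>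
     (\<exists>r :: 'o \<Rightarrow> 'w \<Rightarrow> nat. spine \<kappa> Q r \<and>
        cf_eq (\<le>\<^sup>*) P \<kappa> \<and> cf_eq (\<le>\<^sup>*) Q \<kappa> \<and> cf_eq (\<le>\<^sup>*) (r ` \<kappa>) \<kappa>)"

definition strong_unbounded_pair ::
  "'o::wellorder set \<Rightarrow> ('w \<Rightarrow> nat) set \<Rightarrow> ('w \<Rightarrow> nat) set \<Rightarrow> bool" where
  "strong_unbounded_pair \<kappa> P Q \<longleftrightarrow> unbounded_pair \<kappa> P Q \<and>
     well_order_on Q {(f, g). f \<in> Q \<and> g \<in> Q \<and> f \<le>\<^sup>* g} \<and>
     (\<forall>f\<in>Q. \<forall>g\<in>Q. f \<le> g \<longleftrightarrow> f \<le>\<^sup>* g)"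

definition otp_eq :: "('w \<Rightarrow> nat) set \<Rightarrow> 'o::wellorder \<Rightarrow> bool" where
  "otp_eq R \<alpha> \<longleftrightarrow>
     {(f, g). f \<in> R \<and> g \<in> R \<and> f \<le>\<^sup>* g} =o {(\<beta>, \<gamma>). \<beta> < \<alpha> \<and> \<gamma> < \<alpha> \<and> \<beta> \<le> \<gamma>}"

definition spine_filtration ::
  "'o::wellorder set \<Rightarrow> ('w \<Rightarrow> nat) set \<Rightarrow> ('w \<Rightarrow> nat) set \<Rightarrow>
   ('o \<Rightarrow> ('w \<Rightarrow> nat) set) \<Rightarrow> ('o \<Rightarrow> 'w \<Rightarrow> nat) \<Rightarrow> bool" where
  "spine_filtration \<kappa> P Q Pf Q' \<longleftrightarrow>
     P = (\<Union>\<alpha>\<in>\<kappa>. Pf \<alpha>) \<and>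
     (\<forall>\<alpha>\<in>\<kappa>. \<forall>\<beta>\<in>\<kappa>. \<alpha> \<le> \<beta> \<longrightarrow> Pf \<alpha> \<subseteq> Pf \<beta>) \<and>
     (\<forall>\<delta>\<in>\<kappa>. limit_ord \<delta> \<longrightarrow> Pf \<delta> = (\<Union>\<alpha>\<in>{..<\<delta>}. Pf \<alpha>)) \<and>
     (\<forall>\<alpha>\<in>\<kappa>. \<forall>g\<in>Pf \<alpha>. \<forall>f\<in>P. f \<le>\<^sup>* g \<longrightarrow> f \<in> Pf \<alpha>) \<and>
     (\<forall>\<alpha>\<in>\<kappa>. cf_less (\<le>\<^sup>*) (Pf \<alpha>) \<kappa>) \<and>
     spine \<kappa> Q Q' \<and>
     (\<forall>\<alpha>\<in>\<kappa>. otp_eq (Q' ` \<kappa> \<inter> Pf \<alpha>) \<alpha>)"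

text \<open>
  \<open>twistable_step j T\<close> is \<open>(j + 1)\<close>-twistability for a given spine filtration, with \<open>T\<close> standing for
  \<open>j\<close>-twistability for a pair.  For all \<open>\<alpha>\<close> in \<open>cof_set j\<close>, the premise of its last clause expresses
  \<open>\<alpha> = sup (\<alpha> \<inter> cof_set j)\<close>.
\<close>

definition twistable_step ::
  "nat \<Rightarrow> (('w \<Rightarrow> nat) set \<Rightarrow> ('w \<Rightarrow> nat) set \<Rightarrow> ('w \<times> nat) set \<Rightarrow> bool) \<Rightarrow>
   ('o::wellorder \<Rightarrow> ('w \<Rightarrow> nat) set) \<Rightarrow> ('o \<Rightarrow> 'w \<Rightarrow> nat) \<Rightarrow> ('w \<times> nat) set \<Rightarrow> bool" where
  "twistable_step j T Pf Q' E \<longleftrightarrow>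
     (\<exists>Ef :: 'o \<Rightarrow> ('w \<times> nat) set.
        E = (\<Union>\<alpha>\<in>{ord_zero} \<union> cof_set j. Ef \<alpha>) \<and>
        |Ef ord_zero| \<le>o |omega j :: 'o set| \<and>
        Ef ord_zero \<subseteq> region (Q' ord_zero) \<and>
        (\<forall>\<alpha>\<in>cof_set j.
           Ef \<alpha> \<subseteq> region (Q' \<alpha>) \<and>
           T (Pf \<alpha>) (Q' ` {..<\<alpha>}) (Ef \<alpha>) \<and>
           ((\<forall>\<beta><\<alpha>. \<exists>\<gamma>\<in>cof_set j. \<beta> < \<gamma> \<and> \<gamma> < \<alpha>) \<longrightarrow>
              Ef \<alpha> \<subseteq> (\<Union>\<beta>\<in>({ord_zero} \<union> cof_set j) \<inter> {..<\<alpha>}. Ef \<beta>))))"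

text \<open>The type argument of \<open>twistable_pair\<close> fixes where the ordinals of the filtrations live.\<close>

primrec twistable_pair ::
  "'o::wellorder itself \<Rightarrow> nat \<Rightarrow>
   ('w \<Rightarrow> nat) set \<Rightarrow> ('w \<Rightarrow> nat) set \<Rightarrow> ('w \<times> nat) set \<Rightarrow> bool" where
  "twistable_pair t 0 = (\<lambda>P Q E.
     (\<exists>C. cofinal_in (\<le>\<^sup>*) P C \<and> |C| \<le>o natLeq) \<and>
     |E| =o natLeq \<and> (\<forall>f\<in>P. finite (E \<inter> region f)))"
| "twistable_pair t (Suc j) = (\<lambda>P Q E.
     strong_unbounded_pair (omega (Suc j) :: 'o set) P Q \<and>
     (\<exists>(Pf :: 'o \<Rightarrow> ('w \<Rightarrow> nat) set) Q'.
        spine_filtration (omega (Suc j)) P Q Pf Q' \<and>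
        twistable_step j (twistable_pair t j) Pf Q' E))"

text \<open>Twistability for a given spine filtration makes sense for \<open>k \<ge> 1\<close> only.\<close>

definition twistable ::
  "nat \<Rightarrow> ('o::wellorder \<Rightarrow> ('w \<Rightarrow> nat) set) \<Rightarrow> ('o \<Rightarrow> 'w \<Rightarrow> nat) \<Rightarrow>
   ('w \<times> nat) set \<Rightarrow> bool" where
  "twistable k Pf Q' E \<longleftrightarrow>
     k \<ge> 1 \<and> twistable_step (k - 1) (twistable_pair TYPE('o) (k - 1)) Pf Q' E"

end

theory Submission
  imports Defs "HOL-Library.Nat_Bijection"
begin

text \<open>
  Two facts drive the construction.  A coherent \<open>m\<close>-family on a directed set of cofinality at most
  \<open>\<aleph>\<^bsub>m-1\<^esub>\<close> is trivial (Goblot's vanishing argument, by induction along a well-ordered chain).  And a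
  trivialized \<open>(j+1)\<close>-family on \<open>P\<^sub>\<alpha>\<close> extends to larger index sets in several ways: changing the
  chosen trivialization by a coherent \<open>j\<close>-family \<open>\<Theta>\<close> on \<open>P\<^sub>\<alpha>\<close> changes the values at the tuples that
  end in \<open>Q'(\<alpha>)\<close>.  If \<open>\<Theta>\<close> is nontrivial on \<open>E\<^sub>\<alpha>\<close> (induction on \<open>j\<close>), at most one of the two
  extensions admits a trivialization continuing a prescribed one below \<open>\<alpha>\<close>.  So in a recursion of
  length \<open>\<omega>\<^bsub>j+1\<^esub>\<close> each trivialization guessed by the diamond sequence can be destroyed, and every
  trivialization on \<open>E\<close> is guessed at some stage of a suitable club.
\<close>

section \<open>Families and their boundaries\<close>

text \<open>The diamond sequence guesses only subsets of \<alpha>, yet a guess has to fix the values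
  of a trivialization at every point of \<open>Ef \<alpha>\<close>. The last clause of twistability
  makes this possible: at a limit of stages all points of \<open>Ef \<alpha>\<close> have occurred
  before \<alpha>, so their values at tuples from the spine below \<alpha> can be coded below
  \<alpha>. Nothing is guessed about tuples that contain \<open>Q' \<alpha>\<close>: these carry the
  values from which a trivialization of \<Theta> would be assembled. Hence a stage must refute every
  family with the guessed code, not a single one, and the choice between the two extensions is made
  after the fact: the untwisted one is kept unless some family with the guessed code trivializes it,
  and that family is then the witness against all others for the twisted one. The degrees mesh
  because the index set below a stage has cofinality at most aleph_j, small enough for vanishing in
  degree j + 1, while the induction still provides nontrivial families in degree j.\<close>

lemma le_star_refl [simp]: "f \<le>\<^sup>* f"
  by (simp add: le_star_def)

lemma le_star_trans: "f \<le>\<^sup>* g \<Longrightarrow> g \<le>\<^sup>* h \<Longrightarrow> f \<le>\<^sup>* h"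
  unfolding le_star_def by (erule (1) eventually_elim2) (rule order_trans)

text \<open>Only finitely many columns stick out, each of finite height. So in a tuple the region of
  the first entry is almost contained in that of every later entry, and intersections of domains may
  be replaced by the first region.\<close>

lemma finite_region_diff:
  assumes "f \<le>\<^sup>* g"
  shows "finite (region f - region g)"
proof -
  have "finite {i. \<not> f i \<le> g i}"
    using assms by (simp add: le_star_def eventually_cofinite)
  moreover have "region f - region g \<subseteq> (SIGMA i:{i. \<not> f i \<le> g i}. {..f i})"
    by (auto simp: region_def)
  ultimately show ?thesis
    by (meson finite_SigmaI finite_atMost finite_subset)
qed

lemma tuples_iff: "fs \<in> tuples X m \<longleftrightarrow> length fs = m \<and> set fs \<subseteq> X \<and> sorted_wrt (\<le>\<^sup>*) fs"
  unfolding tuples_def sorted_wrt_iff_nth_less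
  by (auto simp: le_less)

lemma tuples_mono: "fs \<in> tuples X m \<Longrightarrow> X \<subseteq> Y \<Longrightarrow> fs \<in> tuples Y m"
  by (auto simp: tuples_iff)

lemma tuples_snoc:
  assumes "fs \<in> tuples X m" "g \<in> X" "\<And>f. f \<in> set fs \<Longrightarrow> f \<le>\<^sup>* g"
  shows "fs @ [g] \<in> tuples X (Suc m)"
  using assms by (auto simp: tuples_iff sorted_wrt_append)

lemma omit_0 [simp]: "omit 0 (f # fs) = fs"
  and omit_Suc [simp]: "omit (Suc i) (f # fs) = f # omit i fs"
  by (simp_all add: omit_def)

lemma length_omit: "i < length fs \<Longrightarrow> length (omit i fs) = length fs - 1"
  by (simp add: omit_def)

lemma omit_snoc: "i < length fs \<Longrightarrow> omit i (fs @ [g]) = omit i fs @ [g]"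
  by (simp add: omit_def)

lemma omit_last: "omit (length fs) (fs @ [g]) = fs"
  by (simp add: omit_def)

lemma omit_tuples:
  assumes "fs \<in> tuples X (Suc m)" "i \<le> m"
  shows "omit i fs \<in> tuples X m"
proof -
  have i: "i < length fs" using assms by (simp add: tuples_iff)
  have "fs = take i fs @ fs ! i # drop (Suc i) fs"
    using i by (rule id_take_nth_drop)
  moreover have "sorted_wrt (\<le>\<^sup>*) fs" "set fs \<subseteq> X"
    using assms by (auto simp: tuples_iff)
  ultimately have "sorted_wrt (\<le>\<^sup>*) (take i fs @ fs ! i # drop (Suc i) fs)"
    "set (take i fs @ fs ! i # drop (Suc i) fs) \<subseteq> X" by simp_all
  then show ?thesis
    using assms i by (auto simp: tuples_iff omit_def sorted_wrt_append)
qed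

text \<open>
  The empty tuple is given the whole plane as its domain.  A \<open>0\<close>-family is then a single function,
  and triviality of a \<open>1\<close>-family becomes the instance \<open>m = 1\<close> of the general notion.
\<close>

definition reg :: "('w \<Rightarrow> nat) list \<Rightarrow> ('w \<times> nat) set" where
  "reg fs = (case fs of [] \<Rightarrow> UNIV | f # _ \<Rightarrow> region f)"

text \<open>The simplicial coboundary on cochains indexed by tuples. Modulo finite sets, coherent
  families are its cocycles and trivial families its images.\<close>

definition bd :: "'w family \<Rightarrow> 'w family" where
  "bd \<Psi> fs x = (\<Sum>i<length fs. (- 1) ^ i * \<Psi> (omit i fs) x)"

text \<open>Degree 0 is meaningful here: \<open>coh X 0 \<Phi>\<close> says that
  \<open>\<Phi> []\<close> has finite support on each region. Dually, a family trivialized in degree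
  0 has finite support on D. The induction on j starts from these two.\<close>

definition coh :: "('w \<Rightarrow> nat) set \<Rightarrow> nat \<Rightarrow> 'w family \<Rightarrow> bool" where
  "coh X m \<Phi> \<longleftrightarrow> (\<forall>fs\<in>tuples X (Suc m). eq_star_on (reg fs) (bd \<Phi> fs) (\<lambda>x. 0))"

definition trivializes ::
  "('w \<times> nat) set \<Rightarrow> ('w \<Rightarrow> nat) set \<Rightarrow> nat \<Rightarrow> 'w family \<Rightarrow> 'w family \<Rightarrow> bool" where
  "trivializes D X m \<Psi> \<Phi> \<longleftrightarrow> (\<forall>fs\<in>tuples X m. eq_star_on (reg fs \<inter> D) (bd \<Psi> fs) (\<Phi> fs))"

section \<open>Equality modulo finite sets\<close>

lemma eq_star_on_refl [simp]: "eq_star_on A \<phi> \<phi>"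
  by (simp add: eq_star_on_def)

lemma eq_star_on_sym: "eq_star_on A \<phi> \<psi> \<Longrightarrow> eq_star_on A \<psi> \<phi>"
  unfolding eq_star_on_def by (simp add: eq_commute)

lemma eq_star_on_finite_diff:
  assumes "eq_star_on A \<phi> \<psi>" "finite (B - A)"
  shows "eq_star_on B \<phi> \<psi>"
proof -
  have "{x\<in>B. \<phi> x \<noteq> \<psi> x} \<subseteq> {x\<in>A. \<phi> x \<noteq> \<psi> x} \<union> (B - A)" by auto
  then show ?thesis
    using assms unfolding eq_star_on_def by (meson finite_UnI finite_subset)
qed

lemma eq_star_on_subset: "eq_star_on A \<phi> \<psi> \<Longrightarrow> B \<subseteq> A \<Longrightarrow> eq_star_on B \<phi> \<psi>"
  by (rule eq_star_on_finite_diff) (auto simp: Diff_eq_empty_iff[THEN iffD2])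

lemma eq_star_on_lift2:
  assumes "eq_star_on A \<phi> \<phi>'" "eq_star_on A \<psi> \<psi>'"
    and "\<And>x. x \<in> A \<Longrightarrow> \<phi> x = \<phi>' x \<Longrightarrow> \<psi> x = \<psi>' x \<Longrightarrow> \<chi> x = \<chi>' x"
  shows "eq_star_on A \<chi> \<chi>'"
proof -
  have "{x\<in>A. \<chi> x \<noteq> \<chi>' x} \<subseteq> {x\<in>A. \<phi> x \<noteq> \<phi>' x} \<union> {x\<in>A. \<psi> x \<noteq> \<psi>' x}"
    using assms(3) by auto
  then show ?thesis
    using assms(1,2) unfolding eq_star_on_def by (meson finite_UnI finite_subset)
qed

lemma eq_star_on_lift:
  assumes "eq_star_on A \<phi> \<phi>'" "\<And>x. x \<in> A \<Longrightarrow> \<phi> x = \<phi>' x \<Longrightarrow> \<chi> x = \<chi>' x"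
  shows "eq_star_on A \<chi> \<chi>'"
  by (rule eq_star_on_lift2[OF assms(1,1)]) (use assms(2) in auto)

lemma eq_star_on_trans: "eq_star_on A \<phi> \<psi> \<Longrightarrow> eq_star_on A \<psi> \<chi> \<Longrightarrow> eq_star_on A \<phi> \<chi>"
  by (erule (1) eq_star_on_lift2) simp

lemma eq_star_on_sum:
  assumes "finite I" "\<And>i. i \<in> I \<Longrightarrow> eq_star_on A (\<phi> i) (\<psi> i)"
  shows "eq_star_on A (\<lambda>x. \<Sum>i\<in>I. c i * \<phi> i x) (\<lambda>x. \<Sum>i\<in>I. c i * \<psi> i x)"
  using assms
proof (induction I rule: finite_induct)
  case (insert i I)
  have "eq_star_on A (\<phi> i) (\<psi> i)" using insert by auto
  moreover have "eq_star_on A (\<lambda>x. \<Sum>i\<in>I. c i * \<phi> i x) (\<lambda>x. \<Sum>i\<in>I. c i * \<psi> i x)"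
    using insert by auto
  ultimately show ?case
    by (rule eq_star_on_lift2) (use insert.hyps in simp)
qed simp

section \<open>The coboundary operator\<close>

lemma bd_Nil [simp]: "bd \<Psi> [] x = 0"
  by (simp add: bd_def)

lemma bd_Cons: "bd \<Psi> (f # fs) x = \<Psi> fs x - bd (\<lambda>hs. \<Psi> (f # hs)) fs x"
  by (simp add: bd_def sum.lessThan_Suc_shift sum_negf del: sum.lessThan_Suc)

text \<open>Isolates the face without \<open>g\<close>; in all other faces \<open>g\<close> stays at
  the end. Appending a dominating function to all tuples is computed with this.\<close>

lemma bd_snoc:
  "bd \<Psi> (fs @ [g]) x = bd (\<lambda>hs. \<Psi> (hs @ [g])) fs x + (- 1) ^ length fs * \<Psi> fs x"
  by (simp add: bd_def omit_snoc omit_last)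

lemma bd_add: "bd (\<lambda>fs x. \<Phi> fs x + \<Psi> fs x) fs x = bd \<Phi> fs x + bd \<Psi> fs x"
  by (simp add: bd_def distrib_left sum.distrib)

lemma bd_diff: "bd (\<lambda>fs x. \<Phi> fs x - \<Psi> fs x) fs x = bd \<Phi> fs x - bd \<Psi> fs x"
  by (simp add: bd_def right_diff_distrib sum_subtractf)

lemma bd_scale: "bd (\<lambda>fs x. c * \<Psi> fs x) fs x = c * bd \<Psi> fs x"
  by (simp add: bd_def sum_distrib_left mult.left_commute)

text \<open>The usual d d = 0. Splitting off the head cancels the two copies of
  \<open>bd \<Psi> fs\<close> and leaves the claim for the family with \<open>f\<close> put in
  front, so \<Psi> has to vary in the induction.\<close>

lemma bd_bd: "bd (bd \<Psi>) fs x = 0"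
proof (induction fs arbitrary: \<Psi>)
  case (Cons f fs)
  have "bd (bd \<Psi>) (f # fs) x = bd \<Psi> fs x - bd (\<lambda>hs x. \<Psi> hs x - bd (\<lambda>hs. \<Psi> (f # hs)) hs x) fs x"
    by (simp add: bd_Cons[abs_def])
  also have "\<dots> = bd (bd (\<lambda>hs. \<Psi> (f # hs))) fs x"
    by (simp add: bd_diff)
  finally show ?case using Cons.IH by simp
qed simp

text \<open>The domain changes only when the first entry is omitted. The new head then dominates the
  old one, or the list becomes empty and its domain is the whole plane.\<close>

lemma finite_reg_diff_omit:
  assumes "fs \<in> tuples X m" "i < m"
  shows "finite (reg fs - reg (omit i fs))"
proof (cases fs)
  case Nil
  then show ?thesis using assms by (simp add: tuples_iff)
next
  case (Cons f gs)
  show ?thesis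
  proof (cases i)
    case 0
    then show ?thesis
      using Cons assms by (auto simp: reg_def tuples_iff finite_region_diff split: list.splits)
  next
    case (Suc i')
    then show ?thesis using Cons by (simp add: reg_def)
  qed
qed

lemma bd_eq_star:
  assumes "fs \<in> tuples X (Suc m)"
    and "\<And>gs. gs \<in> tuples X m \<Longrightarrow> eq_star_on (reg gs \<inter> D) (\<Phi> gs) (\<Psi> gs)"
  shows "eq_star_on (reg fs \<inter> D) (bd \<Phi> fs) (bd \<Psi> fs)"
  unfolding bd_def[abs_def]
proof (rule eq_star_on_sum)
  fix i assume "i \<in> {..<length fs}"
  then have i: "i < Suc m" using assms(1) by (simp add: tuples_iff)
  have "finite (reg fs \<inter> D - reg (omit i fs) \<inter> D)"
    using finite_reg_diff_omit[OF assms(1) i] by (rule rev_finite_subset) auto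
  then show "eq_star_on (reg fs \<inter> D) (\<Phi> (omit i fs)) (\<Psi> (omit i fs))"
    using assms(2) omit_tuples[OF assms(1)] i eq_star_on_finite_diff by (metis less_Suc_eq_le)
qed simp

text \<open>In the main recursion both extensions are built together with a trivialization, so their
  coherence comes for free from here.\<close>

lemma trivializes_imp_coh:
  assumes "trivializes UNIV X m \<Psi> \<Phi>"
  shows "coh X m \<Phi>"
  unfolding coh_def
proof
  fix fs assume fs: "fs \<in> tuples X (Suc m)"
  have "eq_star_on (reg fs \<inter> UNIV) (bd (bd \<Psi>) fs) (bd \<Phi> fs)"
    by (rule bd_eq_star[OF fs]) (use assms in \<open>auto simp: trivializes_def\<close>)
  then show "eq_star_on (reg fs) (bd \<Phi> fs) (\<lambda>x. 0)"
    by (simp add: bd_bd[abs_def] eq_star_on_sym)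
qed

lemma coh_subset: "coh X m \<Phi> \<Longrightarrow> Y \<subseteq> X \<Longrightarrow> coh Y m \<Phi>"
  unfolding coh_def using tuples_mono by blast

lemma trivializes_subset:
  "trivializes D X m \<Psi> \<Phi> \<Longrightarrow> Y \<subseteq> X \<Longrightarrow> D' \<subseteq> D \<Longrightarrow> trivializes D' Y m \<Psi> \<Phi>"
  unfolding trivializes_def using tuples_mono eq_star_on_subset by (metis inf_mono order_refl)

lemma bd_cong_tuples:
  assumes "fs \<in> tuples X (Suc m)" "\<And>gs. gs \<in> tuples X m \<Longrightarrow> \<Phi> gs = \<Psi> gs"
  shows "bd \<Phi> fs = bd \<Psi> fs"
proof
  fix x
  have "length fs = Suc m" using assms(1) by (simp add: tuples_iff)
  then show "bd \<Phi> fs x = bd \<Psi> fs x"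
    unfolding bd_def using assms omit_tuples[OF assms(1)]
    by (intro sum.cong) (auto simp: less_Suc_eq_le)
qed

lemma coh_cong:
  assumes "coh X m \<Phi>" "\<And>gs. gs \<in> tuples X m \<Longrightarrow> \<Phi> gs = \<Psi> gs"
  shows "coh X m \<Psi>"
  using assms bd_cong_tuples[of _ X m \<Phi> \<Psi>] unfolding coh_def by metis

section \<open>Comparison with the given notions of coherence and triviality\<close>

lemma coh_imp_coherent:
  assumes "coh X m \<Phi>" "1 \<le> m"
  shows "coherent UNIV X m \<Phi>"
proof (cases "m = 1")
  case True
  show ?thesis unfolding coherent_def if_P[OF True]
  proof (intro ballI impI)
    fix f g assume fg: "f \<in> X" "g \<in> X" "f \<le>\<^sup>* g"
    then have "[f, g] \<in> tuples X (Suc m)" using True by (simp add: tuples_iff)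
    then have "eq_star_on (reg [f, g]) (bd \<Phi> [f, g]) (\<lambda>x. 0)"
      using assms(1) by (simp add: coh_def)
    then have "eq_star_on (reg [f, g]) (\<Phi> [f]) (\<Phi> [g])"
      by (rule eq_star_on_lift) (simp add: bd_Cons)
    then show "eq_star_on (fdom UNIV [f] \<inter> fdom UNIV [g]) (\<Phi> [f]) (\<Phi> [g])"
      by (rule eq_star_on_subset) (auto simp: fdom_def reg_def)
  qed
next
  case False
  show ?thesis unfolding coherent_def if_not_P[OF False]
  proof
    fix fs assume fs: "fs \<in> tuples X (m + 1)"
    then have len: "length fs = Suc m" by (simp add: tuples_iff)
    then obtain f gs where fsc: "fs = f # gs" by (cases fs) auto
    have "eq_star_on (reg fs) (bd \<Phi> fs) (\<lambda>x. 0)"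
      using fs assms(1) by (simp add: coh_def)
    moreover have "(\<Inter>i\<le>m. fdom UNIV (omit i fs)) \<subseteq> reg fs"
    proof -
      \<comment> \<open>The face without the second entry keeps the head, so the intersection of all
        face domains already lies in \<open>reg fs\<close>.\<close>
      have "omit 1 fs = f # omit 0 gs" using fsc by simp
      then have "fdom UNIV (omit 1 fs) = reg fs" by (simp add: fdom_def reg_def fsc)
      then show ?thesis using assms(2) by auto
    qed
    moreover have "bd \<Phi> fs = (\<lambda>x. \<Sum>i\<le>m. (- 1) ^ i * \<Phi> (omit i fs) x)"
      by (simp add: bd_def[abs_def] len lessThan_Suc_atMost)
    ultimately show "eq_star_on (\<Inter>i\<le>m. fdom UNIV (omit i fs))
        (\<lambda>x. \<Sum>i\<le>m. (- 1) ^ i * \<Phi> (omit i fs) x) (\<lambda>x. 0)"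
      using eq_star_on_subset by metis
  qed
qed

lemma trivial_imp_trivializes:
  assumes "trivial D X m \<Phi>" "1 \<le> m"
  shows "\<exists>\<Psi>. trivializes D X m \<Psi> \<Phi>"
proof (cases "m = 1")
  case True
  then obtain \<phi> where \<phi>: "\<And>f. f \<in> X \<Longrightarrow> eq_star_on (fdom D [f]) (\<Phi> [f]) \<phi>"
    using assms(1) unfolding trivial_def by auto
  have "trivializes D X m (\<lambda>_. \<phi>) \<Phi>"
    unfolding trivializes_def
  proof
    fix fs assume "fs \<in> tuples X m"
    then obtain f where f: "fs = [f]" "f \<in> X"
      using True by (auto simp: tuples_iff length_Suc_conv)
    have "bd (\<lambda>_. \<phi>) [f] = \<phi>" by (simp add: fun_eq_iff bd_Cons)
    then show "eq_star_on (reg fs \<inter> D) (bd (\<lambda>_. \<phi>) fs) (\<Phi> fs)"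
      using \<phi>[OF f(2)] f(1) by (simp add: reg_def fdom_def eq_star_on_sym)
  qed
  then show ?thesis by blast
next
  case False
  then obtain \<Psi> where \<Psi>: "\<And>fs. fs \<in> tuples X m \<Longrightarrow>
      eq_star_on ((\<Inter>i<m. fdom D (omit i fs)) \<inter> fdom D fs)
        (\<lambda>x. \<Sum>i<m. (- 1) ^ i * \<Psi> (omit i fs) x) (\<Phi> fs)"
    using assms(1) unfolding trivial_def by auto
  have "trivializes D X m \<Psi> \<Phi>"
    unfolding trivializes_def
  proof
    fix fs assume fs: "fs \<in> tuples X m"
    then have len: "length fs = m" by (simp add: tuples_iff)
    have fdom: "fdom D gs = reg gs \<inter> D" if "gs \<noteq> []" for gs :: "('a \<Rightarrow> nat) list"
      using that by (cases gs) (auto simp: fdom_def reg_def)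
    have ne: "omit i fs \<noteq> []" if "i < m" for i
      using that length_omit[of i fs] len False by auto
    \<comment> \<open>The given notion compares functions on the intersection of all face domains;
      what this loses of \<open>reg fs \<inter> D\<close> is finite.\<close>
    have "reg fs \<inter> D - ((\<Inter>i<m. fdom D (omit i fs)) \<inter> fdom D fs)
        \<subseteq> (\<Union>i<m. reg fs - reg (omit i fs))"
    proof -
      have "fs \<noteq> []" using len assms(2) by auto
      then have "fdom D fs = reg fs \<inter> D" by (rule fdom)
      moreover have "(\<Inter>i<m. fdom D (omit i fs)) = (\<Inter>i<m. reg (omit i fs) \<inter> D)"
        using fdom[OF ne] by (intro INF_cong) auto
      ultimately show ?thesis by (simp only:) blast
    qed
    moreover have "finite (\<Union>i<m. reg fs - reg (omit i fs))"
      using finite_reg_diff_omit[OF fs] by (intro finite_UN_I) auto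
    ultimately have "finite (reg fs \<inter> D - ((\<Inter>i<m. fdom D (omit i fs)) \<inter> fdom D fs))"
      by (rule finite_subset)
    moreover have "bd \<Psi> fs = (\<lambda>x. \<Sum>i<m. (- 1) ^ i * \<Psi> (omit i fs) x)"
      by (simp add: bd_def[abs_def] len)
    ultimately show "eq_star_on (reg fs \<inter> D) (bd \<Psi> fs) (\<Phi> fs)"
      using \<Psi>[OF fs] eq_star_on_finite_diff by metis
  qed
  then show ?thesis by blast
qed

section \<open>Unions of increasing chains of index sets\<close>

lemma subset_UN_chain:
  assumes "finite F" "F \<subseteq> (\<Union>\<beta>\<in>I. X \<beta>)" "I \<noteq> {}"
    and "\<And>\<beta> \<gamma>. \<beta> \<in> I \<Longrightarrow> \<gamma> \<in> I \<Longrightarrow> \<beta> \<le> \<gamma> \<Longrightarrow> X \<beta> \<subseteq> X \<gamma>"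
  shows "\<exists>\<beta>\<in>I. F \<subseteq> X (\<beta> :: 'i::linorder)"
  using assms(1,2)
proof (induction F rule: finite_induct)
  case empty
  then show ?case using assms(3) by auto
next
  case (insert x F)
  then obtain \<beta> \<gamma> where "\<beta> \<in> I" "F \<subseteq> X \<beta>" "\<gamma> \<in> I" "x \<in> X \<gamma>" by auto
  then show ?case
    using assms(4)[of \<beta> \<gamma>] assms(4)[of \<gamma> \<beta>] linear[of \<beta> \<gamma>] by blast
qed

text \<open>A tuple is finite, so one stage of the chain contains it. Coherence and trivialization
  therefore pass to unions of chains of any length.\<close>

lemma tuples_UN_chain:
  assumes "fs \<in> tuples (\<Union>\<beta>\<in>I. X \<beta>) m" "1 \<le> m"
    and "\<And>\<beta> \<gamma>. \<beta> \<in> I \<Longrightarrow> \<gamma> \<in> I \<Longrightarrow> \<beta> \<le> \<gamma> \<Longrightarrow> X \<beta> \<subseteq> X \<gamma>"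
  shows "\<exists>\<beta>\<in>I. fs \<in> tuples (X (\<beta> :: 'i::linorder)) m"
proof -
  have "I \<noteq> {}" using assms(1,2) by (auto simp: tuples_iff)
  moreover have "set fs \<subseteq> (\<Union>\<beta>\<in>I. X \<beta>)" using assms(1) by (simp add: tuples_iff)
  ultimately have "\<exists>\<beta>\<in>I. set fs \<subseteq> X \<beta>"
    using assms(3) by (intro subset_UN_chain) simp_all
  then show ?thesis
    using assms(1) by (auto simp: tuples_iff)
qed

lemma coh_UN_chain:
  assumes "\<And>\<beta>. \<beta> \<in> I \<Longrightarrow> coh (X \<beta>) m \<Phi>"
    and "\<And>\<beta> \<gamma>. \<beta> \<in> I \<Longrightarrow> \<gamma> \<in> I \<Longrightarrow> \<beta> \<le> \<gamma> \<Longrightarrow> X \<beta> \<subseteq> X (\<gamma> :: 'i::linorder)"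
  shows "coh (\<Union>\<beta>\<in>I. X \<beta>) m \<Phi>"
  unfolding coh_def
proof
  fix fs assume "fs \<in> tuples (\<Union>\<beta>\<in>I. X \<beta>) (Suc m)"
  then have "\<exists>\<beta>\<in>I. fs \<in> tuples (X \<beta>) (Suc m)"
    by (rule tuples_UN_chain) (simp_all add: assms(2))
  then obtain \<beta> where "\<beta> \<in> I" "fs \<in> tuples (X \<beta>) (Suc m)" by blast
  then show "eq_star_on (reg fs) (bd \<Phi> fs) (\<lambda>x. 0)"
    using assms(1) by (auto simp: coh_def)
qed

lemma directed_UN_chain:
  assumes "I \<noteq> {}" "\<And>\<beta>. \<beta> \<in> I \<Longrightarrow> directed_star (X \<beta>)"
    and "\<And>\<beta> \<gamma>. \<beta> \<in> I \<Longrightarrow> \<gamma> \<in> I \<Longrightarrow> \<beta> \<le> \<gamma> \<Longrightarrow> X \<beta> \<subseteq> X (\<gamma> :: 'i::linorder)"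
  shows "directed_star (\<Union>\<beta>\<in>I. X \<beta>)"
  unfolding directed_star_def
proof (intro conjI ballI)
  have "X \<beta> \<noteq> {}" if "\<beta> \<in> I" for \<beta>
    using assms(2)[OF that] by (simp add: directed_star_def)
  then show "(\<Union>\<beta>\<in>I. X \<beta>) \<noteq> {}"
    using assms(1) by fast
  fix f g assume "f \<in> (\<Union>\<beta>\<in>I. X \<beta>)" "g \<in> (\<Union>\<beta>\<in>I. X \<beta>)"
  then have "\<exists>\<beta>\<in>I. {f, g} \<subseteq> X \<beta>"
    using assms(1,3) by (intro subset_UN_chain) simp_all
  then obtain \<beta> where "\<beta> \<in> I" "f \<in> X \<beta>" "g \<in> X \<beta>" by blast
  then obtain h where "h \<in> X \<beta>" "f \<le>\<^sup>* h" "g \<le>\<^sup>* h"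
    using assms(2)[of \<beta>] by (auto simp: directed_star_def)
  then show "\<exists>h\<in>\<Union>\<beta>\<in>I. X \<beta>. f \<le>\<^sup>* h \<and> g \<le>\<^sup>* h"
    using \<open>\<beta> \<in> I\<close> by blast
qed

section \<open>Extension along well-ordered chains\<close>

text \<open>Transfinite recursion for properties \<open>R \<gamma>\<close> that see F only on
  \<open>A \<gamma>\<close>. Every stage chooses a total function, and new stages keep the old
  values on the old domains, so the stages fit together.\<close>

lemma chain_extension:
  fixes K :: "'i::wellorder set" and A :: "'i \<Rightarrow> 'a set" and R :: "'i \<Rightarrow> ('a \<Rightarrow> 'b) \<Rightarrow> bool"
  assumes local: "\<And>\<gamma> F G. \<gamma> \<in> K \<Longrightarrow> R \<gamma> F \<Longrightarrow> (\<And>x. x \<in> A \<gamma> \<Longrightarrow> F x = G x) \<Longrightarrow> R \<gamma> G"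
    and step: "\<And>\<gamma> F. \<gamma> \<in> K \<Longrightarrow> (\<And>\<beta>. \<beta> \<in> K \<Longrightarrow> \<beta> < \<gamma> \<Longrightarrow> R \<beta> F) \<Longrightarrow>
      \<exists>G. R \<gamma> G \<and> (\<forall>\<beta>\<in>K. \<beta> < \<gamma> \<longrightarrow> (\<forall>x\<in>A \<beta>. G x = F x))"
  shows "\<exists>F. \<forall>\<gamma>\<in>K. R \<gamma> F"
proof -
  \<comment> \<open>\<open>f \<beta>\<close> is the function chosen at stage \<beta>; each point is
    read off at the first stage that contains it. A point outside all \<open>A \<beta>\<close> gets
    an arbitrary value, which no \<open>R \<gamma>\<close> can see.\<close>
  define glue where "glue f x = f (LEAST \<beta>. \<beta> \<in> K \<and> x \<in> A \<beta>) x" for f :: "'i \<Rightarrow> 'a \<Rightarrow> 'b" and x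
  \<comment> \<open>Mentions \<open>f\<close> only below \<gamma>, as dependent choice along a
    well-order requires.\<close>
  define ok where "ok f \<gamma> r \<longleftrightarrow> (\<gamma> \<in> K \<longrightarrow> R \<gamma> r \<and> (\<forall>\<beta>\<in>K. \<beta> < \<gamma> \<longrightarrow> (\<forall>x\<in>A \<beta>. r x = f \<beta> x)))"
    for f \<gamma> r
  have glue: "glue f x = f \<beta> x" if "\<beta> \<in> K" "x \<in> A \<beta>" "ok f \<beta> (f \<beta>)" for f \<beta> x
  proof -
    define \<mu> where "\<mu> = (LEAST \<beta>. \<beta> \<in> K \<and> x \<in> A \<beta>)"
    have "\<mu> \<in> K \<and> x \<in> A \<mu>" unfolding \<mu>_def using that(1,2) by (intro LeastI) auto
    moreover have "\<mu> \<le> \<beta>" unfolding \<mu>_def using that(1,2) by (intro Least_le) auto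
    ultimately show ?thesis
      using that by (auto simp: glue_def ok_def \<mu>_def[symmetric] le_less)
  qed
  have glue_R: "R \<beta> (glue f)" if "\<beta> \<in> K" "ok f \<beta> (f \<beta>)" for f \<beta>
    using local[of \<beta> "f \<beta>" "glue f"] glue[of \<beta> _ f] that by (auto simp: ok_def)
  have "\<exists>f. \<forall>\<gamma>. ok f \<gamma> (f \<gamma>)"
  proof (rule dependent_wellorder_choice)
    fix r and f g :: "'i \<Rightarrow> 'a \<Rightarrow> 'b" and \<gamma> :: 'i
    assume "\<And>\<beta>. \<beta> < \<gamma> \<Longrightarrow> f \<beta> = g \<beta>"
    then show "ok f \<gamma> r = ok g \<gamma> r" unfolding ok_def by auto
  next
    fix \<gamma> f assume IH: "\<And>\<beta>. \<beta> < \<gamma> \<Longrightarrow> ok f \<beta> (f \<beta>)"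
    show "\<exists>r. ok f \<gamma> r"
    proof (cases "\<gamma> \<in> K")
      case True
      then obtain G where "R \<gamma> G" "\<forall>\<beta>\<in>K. \<beta> < \<gamma> \<longrightarrow> (\<forall>x\<in>A \<beta>. G x = glue f x)"
        using step[of \<gamma> "glue f"] glue_R[OF _ IH] by auto
      then have "ok f \<gamma> G" using glue[OF _ _ IH] unfolding ok_def by simp
      then show ?thesis by blast
    qed (simp add: ok_def)
  qed
  then obtain f where "\<And>\<gamma>. ok f \<gamma> (f \<gamma>)" by auto
  then have "\<forall>\<gamma>\<in>K. R \<gamma> (glue f)" using glue_R by auto
  then show ?thesis by (rule exI[of _ "glue f"])
qed

section \<open>Vanishing for small cofinality\<close>

text \<open>Coherent modulo trivial m-families form a cohomology group of functions modulo finite;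
  this says that the group is zero.\<close>

definition vanishes :: "('w \<Rightarrow> nat) set \<Rightarrow> nat \<Rightarrow> bool" where
  "vanishes X m \<longleftrightarrow> (\<forall>\<Phi>. coh X m \<Phi> \<longrightarrow> (\<exists>\<Psi>. trivializes UNIV X m \<Psi> \<Phi>))"

lemma vanishes_empty: "1 \<le> m \<Longrightarrow> vanishes {} m"
  by (auto simp: vanishes_def trivializes_def tuples_iff)

text \<open>Appending the greatest element is a contracting homotopy: coherence at
  \<open>fs @ [g]\<close> expresses \<open>\<Phi> fs\<close> by values at tuples that end in
  \<open>g\<close>.\<close>

lemma vanishes_max:
  assumes "g \<in> X" "\<And>f. f \<in> X \<Longrightarrow> f \<le>\<^sup>* g" "1 \<le> m"
  shows "vanishes X m"
  unfolding vanishes_def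
proof (intro allI impI)
  fix \<Phi> assume \<Phi>: "coh X m \<Phi>"
  \<comment> \<open>By \<open>bd_snoc\<close>, coherence reads \<open>bd (\<lambda>hs. \<Phi> (hs @
    [g])) fs x + (- 1) ^ m * \<Phi> fs x = 0\<close>, which dictates the sign.\<close>
  define \<Psi> where "\<Psi> = (\<lambda>hs x. - ((- 1) ^ m) * \<Phi> (hs @ [g]) x)"
  have "trivializes UNIV X m \<Psi> \<Phi>"
    unfolding trivializes_def
  proof
    fix fs assume fs: "fs \<in> tuples X m"
    then have len: "length fs = m" by (simp add: tuples_iff)
    have "fs @ [g] \<in> tuples X (Suc m)"
      using fs assms(1,2) by (intro tuples_snoc) (auto simp: tuples_iff)
    then have "eq_star_on (reg (fs @ [g])) (bd \<Phi> (fs @ [g])) (\<lambda>x. 0)"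
      using \<Phi> by (simp add: coh_def)
    moreover have "reg (fs @ [g]) = reg fs"
      using len assms(3) by (cases fs) (auto simp: reg_def)
    ultimately have "eq_star_on (reg fs) (bd \<Phi> (fs @ [g])) (\<lambda>x. 0)" by simp
    then have "eq_star_on (reg fs) (bd \<Psi> fs) (\<Phi> fs)"
    proof (rule eq_star_on_lift)
      fix x assume "bd \<Phi> (fs @ [g]) x = 0"
      then have eq: "bd (\<lambda>hs. \<Phi> (hs @ [g])) fs x = - ((- 1) ^ m) * \<Phi> fs x"
        by (simp add: bd_snoc len)
      have "(- 1 :: int) ^ m * ((- 1) ^ m * c) = c" for c
        by (simp add: mult.assoc[symmetric] power_mult_distrib[symmetric])
      then show "bd \<Psi> fs x = \<Phi> fs x"
        unfolding \<Psi>_def bd_scale eq by simp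
    qed
    then show "eq_star_on (reg fs \<inter> UNIV) (bd \<Psi> fs) (\<Phi> fs)" by simp
  qed
  then show "\<exists>\<Psi>. trivializes UNIV X m \<Psi> \<Phi>" by blast
qed

text \<open>Reading x off at the first n whose region contains it gives one function \<psi>. On the
  region of \<open>g n\<close> only the indices up to n occur, and each of them contributes finitely
  many disagreements.\<close>

lemma vanishes_sequence_1:
  fixes g :: "nat \<Rightarrow> 'w \<Rightarrow> nat"
  assumes "range g \<subseteq> X" "\<And>m n. m \<le> n \<Longrightarrow> g m \<le>\<^sup>* g n" "\<And>f. f \<in> X \<Longrightarrow> \<exists>n. f \<le>\<^sup>* g n"
  shows "vanishes X 1"
  unfolding vanishes_def
proof (intro allI impI)
  fix \<Phi> assume \<Phi>: "coh X 1 \<Phi>"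
  have coh: "eq_star_on (region f) (\<Phi> [f]) (\<Phi> [h])" if "f \<in> X" "h \<in> X" "f \<le>\<^sup>* h" for f h
  proof -
    have "[f, h] \<in> tuples X (Suc 1)" using that by (simp add: tuples_iff)
    then have "eq_star_on (reg [f, h]) (bd \<Phi> [f, h]) (\<lambda>x. 0)"
      using \<Phi> by (simp only: coh_def)
    then have "eq_star_on (reg [f, h]) (\<Phi> [f]) (\<Phi> [h])"
      by (rule eq_star_on_lift) (simp add: bd_Cons)
    then show ?thesis by (simp add: reg_def)
  qed
  define \<psi> where "\<psi> x = \<Phi> [g (LEAST n. x \<in> region (g n))] x" for x
  have \<psi>: "eq_star_on (region (g n)) \<psi> (\<Phi> [g n])" for n
  proof -
    have "{x \<in> region (g n). \<psi> x \<noteq> \<Phi> [g n] x}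
      \<subseteq> (\<Union>m\<le>n. {x \<in> region (g m). \<Phi> [g m] x \<noteq> \<Phi> [g n] x})"
    proof
      fix x assume x: "x \<in> {x \<in> region (g n). \<psi> x \<noteq> \<Phi> [g n] x}"
      define m where "m = (LEAST n. x \<in> region (g n))"
      have "x \<in> region (g m)" unfolding m_def using x by (auto intro: LeastI)
      moreover have "m \<le> n" unfolding m_def using x by (intro Least_le) auto
      ultimately show "x \<in> (\<Union>m\<le>n. {x \<in> region (g m). \<Phi> [g m] x \<noteq> \<Phi> [g n] x})"
        using x by (auto simp: \<psi>_def m_def[symmetric])
    qed
    moreover have "finite {x \<in> region (g m). \<Phi> [g m] x \<noteq> \<Phi> [g n] x}" if "m \<le> n" for m
      using coh[of "g m" "g n"] assms(1,2) that by (auto simp: eq_star_on_def)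
    ultimately show ?thesis
      unfolding eq_star_on_def by (meson finite_UN_I finite_atMost atMost_iff finite_subset)
  qed
  have "trivializes UNIV X 1 (\<lambda>_. \<psi>) \<Phi>"
    unfolding trivializes_def
  proof
    fix fs assume "fs \<in> tuples X 1"
    then obtain f where f: "fs = [f]" "f \<in> X" by (auto simp: tuples_iff length_Suc_conv)
    obtain n where n: "f \<le>\<^sup>* g n" using assms(3)[OF f(2)] ..
    have "eq_star_on (region f) \<psi> (\<Phi> [g n])"
      using eq_star_on_finite_diff[OF \<psi> finite_region_diff[OF n]] .
    moreover have "eq_star_on (region f) (\<Phi> [f]) (\<Phi> [g n])"
      using assms(1) f(2) n by (intro coh) auto
    ultimately have "eq_star_on (region f) \<psi> (\<Phi> [f])"
      using eq_star_on_sym eq_star_on_trans by blast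
    moreover have "bd (\<lambda>_. \<psi>) [f] = \<psi>" by (simp add: fun_eq_iff bd_Cons)
    ultimately show "eq_star_on (reg fs \<inter> UNIV) (bd (\<lambda>_. \<psi>) fs) (\<Phi> fs)"
      by (simp add: f(1) reg_def)
  qed
  then show "\<exists>\<Psi>. trivializes UNIV X 1 \<Psi> \<Phi>" by blast
qed

text \<open>Trivializations of one family differ by a coherent p-family. The family F built so far
  and some trivialization F' on \<open>X \<gamma>\<close> therefore differ below \<gamma> by a
  coboundary, by vanishing in degree p. Adding this coboundary to F' leaves \<open>bd F'\<close>
  unchanged and makes F' fit F.\<close>

lemma vanishes_chain:
  fixes K :: "'i::wellorder set" and X :: "'i \<Rightarrow> ('w \<Rightarrow> nat) set"
  assumes mono: "\<And>\<beta> \<gamma>. \<beta> \<in> K \<Longrightarrow> \<gamma> \<in> K \<Longrightarrow> \<beta> \<le> \<gamma> \<Longrightarrow> X \<beta> \<subseteq> X \<gamma>"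
    and top: "\<And>\<gamma>. \<gamma> \<in> K \<Longrightarrow> vanishes (X \<gamma>) (Suc p)"
    and below: "\<And>\<gamma>. \<gamma> \<in> K \<Longrightarrow> vanishes (\<Union>\<beta>\<in>{\<beta>\<in>K. \<beta> < \<gamma>}. X \<beta>) p"
    and p: "1 \<le> p"
  shows "vanishes (\<Union>\<gamma>\<in>K. X \<gamma>) (Suc p)"
  unfolding vanishes_def
proof (intro allI impI)
  fix \<Phi> assume \<Phi>: "coh (\<Union>\<gamma>\<in>K. X \<gamma>) (Suc p) \<Phi>"
  have "\<exists>\<Psi>. \<forall>\<gamma>\<in>K. trivializes UNIV (X \<gamma>) (Suc p) \<Psi> \<Phi>"
  proof (rule chain_extension[where A = "\<lambda>\<gamma>. tuples (X \<gamma>) p"])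
    fix \<gamma> and F G :: "'w family"
    assume "trivializes UNIV (X \<gamma>) (Suc p) F \<Phi>" "\<And>x. x \<in> tuples (X \<gamma>) p \<Longrightarrow> F x = G x"
    then show "trivializes UNIV (X \<gamma>) (Suc p) G \<Phi>"
      using bd_cong_tuples[of _ "X \<gamma>" p F G] unfolding trivializes_def by metis
  next
    fix \<gamma> F assume \<gamma>: "\<gamma> \<in> K"
      and F: "\<And>\<beta>. \<beta> \<in> K \<Longrightarrow> \<beta> < \<gamma> \<Longrightarrow> trivializes UNIV (X \<beta>) (Suc p) F \<Phi>"
    define Y where "Y = (\<Union>\<beta>\<in>{\<beta>\<in>K. \<beta> < \<gamma>}. X \<beta>)"
    have YX: "Y \<subseteq> X \<gamma>" unfolding Y_def using mono \<gamma> by fastforce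
    have "coh (X \<gamma>) (Suc p) \<Phi>" by (rule coh_subset[OF \<Phi>]) (use \<gamma> in blast)
    then obtain F' where F': "trivializes UNIV (X \<gamma>) (Suc p) F' \<Phi>"
      using top[OF \<gamma>] by (auto simp: vanishes_def)
    have FY: "eq_star_on (reg fs) (bd F fs) (\<Phi> fs)" if "fs \<in> tuples Y (Suc p)" for fs
    proof -
      have "\<exists>\<beta>\<in>{\<beta>\<in>K. \<beta> < \<gamma>}. fs \<in> tuples (X \<beta>) (Suc p)"
        using that unfolding Y_def by (rule tuples_UN_chain) (simp_all add: mono)
      then obtain \<beta> where "\<beta> \<in> K" "\<beta> < \<gamma>" "fs \<in> tuples (X \<beta>) (Suc p)" by auto
      then show ?thesis using F[of \<beta>] by (simp add: trivializes_def)
    qed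
    have "coh Y p (\<lambda>fs x. F fs x - F' fs x)"
      unfolding coh_def
    proof
      fix fs assume fs: "fs \<in> tuples Y (Suc p)"
      have "eq_star_on (reg fs) (bd F' fs) (\<Phi> fs)"
        using F' tuples_mono[OF fs YX] by (simp add: trivializes_def)
      with FY[OF fs] show "eq_star_on (reg fs) (bd (\<lambda>fs x. F fs x - F' fs x) fs) (\<lambda>x. 0)"
        by (rule eq_star_on_lift2) (simp add: bd_diff)
    qed
    then obtain \<Theta> where \<Theta>: "trivializes UNIV Y p \<Theta> (\<lambda>fs x. F fs x - F' fs x)"
      using below[OF \<gamma>] by (auto simp: vanishes_def Y_def)
    \<comment> \<open>The correction matches F only modulo finite sets, whereas
      \<open>chain_extension\<close> asks for equality on earlier tuples. Overwriting by F there
      costs finitely many points per tuple.\<close>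
    define G where "G fs = (if fs \<in> tuples Y p then F fs else (\<lambda>x. F' fs x + bd \<Theta> fs x))" for fs
    have G: "eq_star_on (reg fs \<inter> UNIV) (G fs) (\<lambda>x. F' fs x + bd \<Theta> fs x)" for fs
    proof (cases "fs \<in> tuples Y p")
      case True
      then have "eq_star_on (reg fs) (bd \<Theta> fs) (\<lambda>x. F fs x - F' fs x)"
        using \<Theta> by (simp add: trivializes_def)
      then have "eq_star_on (reg fs) (F fs) (\<lambda>x. F' fs x + bd \<Theta> fs x)"
        by (rule eq_star_on_lift) simp
      then show ?thesis using True by (simp add: G_def)
    qed (simp add: G_def)
    have "trivializes UNIV (X \<gamma>) (Suc p) G \<Phi>"
      unfolding trivializes_def
    proof
      fix fs assume fs: "fs \<in> tuples (X \<gamma>) (Suc p)"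
      have "eq_star_on (reg fs \<inter> UNIV) (bd G fs) (bd (\<lambda>fs x. F' fs x + bd \<Theta> fs x) fs)"
        by (rule bd_eq_star[OF fs G])
      moreover have "bd (\<lambda>fs x. F' fs x + bd \<Theta> fs x) fs = bd F' fs"
        by (simp add: fun_eq_iff bd_add bd_bd)
      moreover have "eq_star_on (reg fs \<inter> UNIV) (bd F' fs) (\<Phi> fs)"
        using F' fs by (simp add: trivializes_def)
      ultimately show "eq_star_on (reg fs \<inter> UNIV) (bd G fs) (\<Phi> fs)"
        using eq_star_on_trans by metis
    qed
    moreover have "\<forall>\<beta>\<in>K. \<beta> < \<gamma> \<longrightarrow> (\<forall>x\<in>tuples (X \<beta>) p. G x = F x)"
    proof (intro ballI impI)
      fix \<beta> fs assume "\<beta> \<in> K" "\<beta> < \<gamma>" "fs \<in> tuples (X \<beta>) p"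
      then have "fs \<in> tuples Y p" unfolding Y_def by (elim tuples_mono) auto
      then show "G fs = F fs" by (simp add: G_def)
    qed
    ultimately show "\<exists>G. trivializes UNIV (X \<gamma>) (Suc p) G \<Phi> \<and>
        (\<forall>\<beta>\<in>K. \<beta> < \<gamma> \<longrightarrow> (\<forall>x\<in>tuples (X \<beta>) p. G x = F x))"
      by (intro exI[of _ G]) (rule conjI)
  qed
  then obtain \<Psi> where \<Psi>: "\<And>\<gamma>. \<gamma> \<in> K \<Longrightarrow> trivializes UNIV (X \<gamma>) (Suc p) \<Psi> \<Phi>" by auto
  have "trivializes UNIV (\<Union>\<gamma>\<in>K. X \<gamma>) (Suc p) \<Psi> \<Phi>"
    unfolding trivializes_def
  proof
    fix fs assume "fs \<in> tuples (\<Union>\<gamma>\<in>K. X \<gamma>) (Suc p)"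
    then have "\<exists>\<beta>\<in>K. fs \<in> tuples (X \<beta>) (Suc p)"
      by (rule tuples_UN_chain) (simp_all add: mono)
    then obtain \<beta> where "\<beta> \<in> K" "fs \<in> tuples (X \<beta>) (Suc p)" by auto
    then show "eq_star_on (reg fs \<inter> UNIV) (bd \<Psi> fs) (\<Phi> fs)"
      using \<Psi>[of \<beta>] by (simp add: trivializes_def)
  qed
  then show "\<exists>\<Psi>. trivializes UNIV (\<Union>\<gamma>\<in>K. X \<gamma>) (Suc p) \<Psi> \<Phi>" by blast
qed

lemma cofinal_sequence:
  assumes "directed_star X" "cofinal_in (\<le>\<^sup>*) X C" "|C| \<le>o natLeq"
  obtains g :: "nat \<Rightarrow> 'w \<Rightarrow> nat"
  where "range g \<subseteq> X" "\<And>m n. m \<le> n \<Longrightarrow> g m \<le>\<^sup>* g n" "\<And>f. f \<in> X \<Longrightarrow> \<exists>n. f \<le>\<^sup>* g n"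
proof -
  have "C \<noteq> {}" using assms(1,2) by (auto simp: directed_star_def cofinal_in_def)
  moreover have "|C| \<le>o |UNIV :: nat set|"
    using assms(3) card_of_nat ordIso_symmetric ordLeq_ordIso_trans by blast
  ultimately obtain c :: "nat \<Rightarrow> 'w \<Rightarrow> nat" where c: "range c = C"
    using card_of_ordLeq2[of C "UNIV :: nat set"] by blast
  have CX: "C \<subseteq> X" using assms(2) by (simp add: cofinal_in_def)
  have "\<exists>g. g 0 \<in> X \<and> (\<forall>n. (g (Suc n) \<in> X) \<and> (g n \<in> X \<longrightarrow> g n \<le>\<^sup>* g (Suc n)) \<and> c n \<le>\<^sup>* g (Suc n))"
  proof -
    have "\<forall>n f. \<exists>h. f \<in> X \<longrightarrow> h \<in> X \<and> f \<le>\<^sup>* h \<and> c n \<le>\<^sup>* h"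
      using assms(1) CX c unfolding directed_star_def by (metis rangeI subsetD)
    then obtain u where u: "\<And>n f. f \<in> X \<Longrightarrow> u n f \<in> X \<and> f \<le>\<^sup>* u n f \<and> c n \<le>\<^sup>* u n f"
      by metis
    define g where "g = rec_nat (c 0) u"
    have "g 0 \<in> X" using CX c by (auto simp: g_def)
    moreover have "g n \<in> X" for n
      by (induction n) (use CX c u in \<open>auto simp: g_def\<close>)
    ultimately show ?thesis
      using u by (intro exI[of _ g]) (auto simp: g_def)
  qed
  then obtain g where g: "g 0 \<in> X"
    "\<And>n. g (Suc n) \<in> X" "\<And>n. g n \<in> X \<Longrightarrow> g n \<le>\<^sup>* g (Suc n)" "\<And>n. c n \<le>\<^sup>* g (Suc n)" by auto
  have gX: "g n \<in> X" for n using g(1,2) by (cases n) auto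
  have "g m \<le>\<^sup>* g n" if "m \<le> n" for m n
    using that by (induction rule: dec_induct) (auto intro: le_star_trans g(3) gX)
  moreover have "\<exists>n. f \<le>\<^sup>* g n" if f: "f \<in> X" for f
  proof -
    obtain n where "f \<le>\<^sup>* c n" using assms(2) f c by (auto simp: cofinal_in_def)
    then show ?thesis using g(4) le_star_trans by blast
  qed
  ultimately show ?thesis using gX by (intro that[of g]) auto
qed

text \<open>Degree 1 is done directly, since \<open>vanishes_chain\<close> only yields degrees from
  2 on. In higher degrees the functions below \<open>g n\<close> have a greatest element, so all
  pieces vanish in every positive degree.\<close>

lemma vanishes_countable:
  fixes X :: "('w \<Rightarrow> nat) set"
  assumes "directed_star X" "cofinal_in (\<le>\<^sup>*) X C" "|C| \<le>o natLeq" "1 \<le> m"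
  shows "vanishes X m"
proof -
  obtain g :: "nat \<Rightarrow> 'w \<Rightarrow> nat" where g: "range g \<subseteq> X" "\<And>m n. m \<le> n \<Longrightarrow> g m \<le>\<^sup>* g n"
    "\<And>f. f \<in> X \<Longrightarrow> \<exists>n. f \<le>\<^sup>* g n"
    using cofinal_sequence[OF assms(1-3)] by blast
  show ?thesis
  proof (cases "m = 1")
    case True
    then show ?thesis using vanishes_sequence_1[OF g] by simp
  next
    case False
    then obtain p where p: "m = Suc p" "1 \<le> p" using assms(4) by (cases m) auto
    define Y where "Y n = {f \<in> X. f \<le>\<^sup>* g n}" for n
    have mono: "Y n \<subseteq> Y k" if "n \<le> k" for n k
      unfolding Y_def using g(2)[OF that] le_star_trans by blast
    have Y: "vanishes (Y n) q" if "1 \<le> q" for n q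
      by (rule vanishes_max[of "g n"]) (use g(1) that in \<open>auto simp: Y_def\<close>)
    have "vanishes (\<Union>n\<in>UNIV. Y n) (Suc p)"
    proof (rule vanishes_chain)
      fix n :: nat
      show "vanishes (\<Union>k\<in>{k\<in>UNIV. k < n}. Y k) p"
      proof (cases n)
        case 0
        then show ?thesis using vanishes_empty p(2) by simp
      next
        case (Suc n')
        have "(\<Union>k\<in>{k\<in>UNIV. k < n}. Y k) = Y n'"
          using mono[of _ n'] Suc by (auto simp: less_Suc_eq_le)
        then show ?thesis using Y p(2) by simp
      qed
    qed (use mono Y p in auto)
    moreover have "(\<Union>n\<in>UNIV. Y n) = X" using g(3) by (auto simp: Y_def)
    ultimately show ?thesis by (simp add: p(1))
  qed
qed

section \<open>Successor cardinals\<close>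

lemma ord_zero_le [simp]: "ord_zero \<le> \<alpha>"
  unfolding ord_zero_def by (rule Least_le) simp

lemma limit_ord_pos:
  assumes "limit_ord \<alpha>"
  shows "ord_zero < \<alpha>"
proof -
  have "ord_zero \<noteq> \<alpha>" using assms by (auto simp: limit_ord_def)
  with ord_zero_le show ?thesis by (rule le_neq_trans)
qed

section \<open>Cardinal bounds by an infinite set\<close>

lemma card_of_finite_le: "infinite B \<Longrightarrow> finite A \<Longrightarrow> |A| \<le>o |B|"
  by (meson finite_iff_ordLess_natLeq infinite_iff_natLeq_ordLeq ordLess_imp_ordLeq ordLeq_transitive)

lemma card_of_Un_le:
  assumes "infinite C" "|A| \<le>o |C|" "|B| \<le>o |C|"
  shows "|A \<union> B| \<le>o |C|"
  using assms by (intro card_of_Un_ordLeq_infinite_Field) (simp_all add: Field_card_of card_of_card_order_on)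

lemma card_of_Times_le:
  assumes "infinite C" "|A| \<le>o |C|" "|B| \<le>o |C|"
  shows "|A \<times> B| \<le>o |C|"
  using assms by (intro card_of_Times_ordLeq_infinite_Field) (simp_all add: Field_card_of card_of_card_order_on)

lemma card_of_countable_le:
  assumes "infinite B" "|A| \<le>o natLeq"
  shows "|A| \<le>o |B|"
proof -
  have "natLeq \<le>o |B|" using assms(1) infinite_iff_natLeq_ordLeq[of B] by simp
  with assms(2) show ?thesis by (rule ordLeq_transitive)
qed

lemma card_of_image_le: "|A| \<le>o |B| \<Longrightarrow> |f ` A| \<le>o |B|"
  by (rule ordLeq_transitive[OF card_of_image])

lemma card_of_subset_le: "|A| \<le>o |B| \<Longrightarrow> A' \<subseteq> A \<Longrightarrow> |A'| \<le>o |B|"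
  by (rule ordLeq_transitive[OF card_of_mono1])

lemma card_of_lists_le:
  assumes "infinite B" "|A| \<le>o |B|"
  shows "|{xs. set xs \<subseteq> A \<and> length xs = n}| \<le>o |B|"
proof (induction n)
  case 0
  have "{xs. set xs \<subseteq> A \<and> length xs = 0} \<subseteq> {[]}" by auto
  then show ?case using assms(1) by (meson card_of_finite_le finite.simps finite_subset)
next
  case (Suc n)
  have "{xs. set xs \<subseteq> A \<and> length xs = Suc n}
      = (\<lambda>(x, xs). x # xs) ` (A \<times> {xs. set xs \<subseteq> A \<and> length xs = n})"
    by (auto simp: length_Suc_conv image_iff)
  then show ?case
    using card_of_image_le[OF card_of_Times_le[OF assms Suc]] by simp
qed

text \<open>\<kappa> is the successor cardinal of \<open>|\<mu>|\<close> as an initial segment. In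
  an ambient type that is too short, \<open>\<kappa>_eq\<close> could make \<kappa> the whole type;
  \<open>\<mu>_less_\<kappa>\<close> excludes this and is the source of regularity.\<close>

locale successor_cardinal =
  fixes \<kappa> \<mu> :: "'o::wellorder set"
  assumes \<kappa>_eq: "\<kappa> = {\<alpha>. |{..<\<alpha>}| \<le>o |\<mu>|}"
    and infinite_\<mu>: "infinite \<mu>"
    and \<mu>_less_\<kappa>: "|\<mu>| <o |\<kappa>|"
begin

lemma infinite_\<kappa>: "infinite \<kappa>"
  by (rule card_of_ordLeq_infinite[OF ordLess_imp_ordLeq[OF \<mu>_less_\<kappa>] infinite_\<mu>])

lemma \<kappa>_downward: "\<alpha> \<in> \<kappa> \<Longrightarrow> \<beta> \<le> \<alpha> \<Longrightarrow> \<beta> \<in> \<kappa>"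
  unfolding \<kappa>_eq by (auto elim: card_of_subset_le)

lemma card_of_lessThan: "\<alpha> \<in> \<kappa> \<Longrightarrow> |{..<\<alpha>}| \<le>o |\<mu>|"
  by (simp add: \<kappa>_eq)

lemma card_of_atMost:
  assumes "\<alpha> \<in> \<kappa>"
  shows "|{..\<alpha>}| \<le>o |\<mu>|"
proof -
  have "{..\<alpha>} = {..<\<alpha>} \<union> {\<alpha>}" by auto
  then show ?thesis
    using card_of_Un_le[OF infinite_\<mu> card_of_lessThan[OF assms], of "{\<alpha>}"]
    by (simp add: card_of_finite_le infinite_\<mu>)
qed

text \<open>Regularity of \<kappa>: at most \<open>|\<mu>|\<close> initial segments, each of size at
  most \<open>|\<mu>|\<close>, cannot cover it.\<close>

lemma bounded:
  assumes "B \<subseteq> \<kappa>" "|B| \<le>o |\<mu>|"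
  shows "\<exists>\<gamma>\<in>\<kappa>. \<forall>\<beta>\<in>B. \<beta> < \<gamma>"
proof -
  have "|\<Union>\<beta>\<in>B. {..\<beta>}| \<le>o |\<mu>|"
    using assms card_of_atMost by (intro card_of_UNION_ordLeq_infinite infinite_\<mu>) auto
  then have "\<not> \<kappa> \<subseteq> (\<Union>\<beta>\<in>B. {..\<beta>})"
    using \<mu>_less_\<kappa> card_of_subset_le not_ordLess_ordLeq by blast
  then obtain \<gamma> where "\<gamma> \<in> \<kappa>" "\<gamma> \<notin> (\<Union>\<beta>\<in>B. {..\<beta>})" by blast
  then have "\<forall>\<beta>\<in>B. \<beta> < \<gamma>" by (auto simp: not_le)
  then show ?thesis using \<open>\<gamma> \<in> \<kappa>\<close> by blast
qed

text \<open>No cardinal lies strictly between. A larger A would embed into \<kappa>, and the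
  covering argument with \<open>|A|\<close> in place of \<open>|\<mu>|\<close> would bound its
  image, hence inject A into a set of size at most \<open>|\<mu>|\<close>.\<close>

lemma card_less_imp_le:
  assumes "|A| <o |\<kappa>|"
  shows "|A| \<le>o |\<mu>|"
proof (rule ccontr)
  assume "\<not> |A| \<le>o |\<mu>|"
  then have \<mu>A: "|\<mu>| \<le>o |A|" using ordLeq_total[OF card_of_Well_order[of A] card_of_Well_order[of \<mu>]] by blast
  then have infA: "infinite A" using infinite_\<mu> card_of_ordLeq_infinite by blast
  have "|A| \<le>o |\<kappa>|" using assms by (rule ordLess_imp_ordLeq)
  then obtain e where e: "inj_on e A" "e ` A \<subseteq> \<kappa>"
    unfolding card_of_ordLeq[symmetric] by auto
  have "|\<Union>\<beta>\<in>e ` A. {..\<beta>}| \<le>o |A|"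
  proof (rule card_of_UNION_ordLeq_infinite[OF infA card_of_image], rule ballI)
    fix \<beta> assume "\<beta> \<in> e ` A"
    then show "|{..\<beta>}| \<le>o |A|"
      using e(2) card_of_atMost \<mu>A ordLeq_transitive by blast
  qed
  then have "\<not> \<kappa> \<subseteq> (\<Union>\<beta>\<in>e ` A. {..\<beta>})"
    using assms card_of_subset_le not_ordLess_ordLeq by blast
  then obtain \<gamma> where \<gamma>': "\<gamma> \<in> \<kappa>" "\<gamma> \<notin> (\<Union>\<beta>\<in>e ` A. {..\<beta>})" by blast
  then have \<gamma>: "\<gamma> \<in> \<kappa>" "e ` A \<subseteq> {..<\<gamma>}" by (auto simp: not_le)
  have "|A| \<le>o |{..<\<gamma>}|" using e(1) \<gamma>(2) card_of_ordLeq by blast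
  then have "|A| \<le>o |\<mu>|" using card_of_lessThan[OF \<gamma>(1)] ordLeq_transitive by blast
  then show False using \<open>\<not> |A| \<le>o |\<mu>|\<close> by simp
qed

text \<open>Prepares the use of diamond: what occurs by stage \<beta> has its code below
  \<open>h \<beta>\<close>. At a closure point \<alpha> of h, everything that occurs before \<alpha>
  is thus coded below \<alpha>.\<close>

lemma bounded_coding:
  assumes "\<And>\<beta>. \<beta> \<in> \<kappa> \<Longrightarrow> |A \<beta>| \<le>o |\<mu>|"
  obtains e h where "inj_on e (\<Union>\<beta>\<in>\<kappa>. A \<beta>)" "e ` (\<Union>\<beta>\<in>\<kappa>. A \<beta>) \<subseteq> \<kappa>"
    "\<And>\<beta>. \<beta> \<in> \<kappa> \<Longrightarrow> h \<beta> \<in> \<kappa>" "\<And>\<beta> a. \<beta> \<in> \<kappa> \<Longrightarrow> a \<in> A \<beta> \<Longrightarrow> e a < h \<beta>"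
proof -
  have "|A \<beta>| \<le>o |\<kappa>|" if "\<beta> \<in> \<kappa>" for \<beta>
    using assms[OF that] ordLess_imp_ordLeq[OF \<mu>_less_\<kappa>] by (rule ordLeq_transitive)
  then have "|\<Union>\<beta>\<in>\<kappa>. A \<beta>| \<le>o |\<kappa>|"
    by (intro card_of_UNION_ordLeq_infinite infinite_\<kappa> card_of_mono1 order_refl) simp
  then obtain e where e: "inj_on e (\<Union>\<beta>\<in>\<kappa>. A \<beta>)" "e ` (\<Union>\<beta>\<in>\<kappa>. A \<beta>) \<subseteq> \<kappa>"
    unfolding card_of_ordLeq[symmetric] by auto
  have "\<exists>\<gamma>. \<gamma> \<in> \<kappa> \<and> (\<forall>a\<in>A \<beta>. e a < \<gamma>)" if "\<beta> \<in> \<kappa>" for \<beta>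
    using bounded[of "e ` A \<beta>"] card_of_image_le[OF assms[OF that], of e] e(2) that by blast
  then obtain h where "\<And>\<beta>. \<beta> \<in> \<kappa> \<Longrightarrow> h \<beta> \<in> \<kappa> \<and> (\<forall>a\<in>A \<beta>. e a < h \<beta>)" by metis
  then show ?thesis using e by (intro that[of e h]) auto
qed

lemma club_closure_points:
  assumes h: "\<And>\<beta>. \<beta> \<in> \<kappa> \<Longrightarrow> h \<beta> \<in> \<kappa>"
  shows "club_in \<kappa> {\<alpha>\<in>\<kappa>. limit_ord \<alpha> \<and> (\<forall>\<beta><\<alpha>. h \<beta> < \<alpha>)}"
  unfolding club_in_def
proof (intro conjI ballI impI)
  fix \<alpha> assume \<alpha>: "\<alpha> \<in> \<kappa>"
  have "\<exists>\<gamma>. \<gamma> \<in> \<kappa> \<and> \<beta> < \<gamma> \<and> (\<forall>\<beta>'\<le>\<beta>. h \<beta>' < \<gamma>)" if \<beta>: "\<beta> \<in> \<kappa>" for \<beta>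
  proof -
    have "h ` {..\<beta>} \<union> {\<beta>} \<subseteq> \<kappa>" using \<beta> h \<kappa>_downward by auto
    moreover have "|h ` {..\<beta>} \<union> {\<beta>}| \<le>o |\<mu>|"
      by (intro card_of_Un_le card_of_image_le card_of_atMost \<beta> card_of_finite_le infinite_\<mu>) simp
    ultimately show ?thesis using bounded by (metis Un_iff atMost_iff imageI singletonI)
  qed
  then obtain s where s: "\<And>\<beta>. \<beta> \<in> \<kappa> \<Longrightarrow> s \<beta> \<in> \<kappa> \<and> \<beta> < s \<beta> \<and> (\<forall>\<beta>'\<le>\<beta>. h \<beta>' < s \<beta>)"
    by metis
  define a where "a n = (s ^^ n) \<alpha>" for n
  have a: "a n \<in> \<kappa>" for n by (induction n) (simp_all add: a_def \<alpha> s)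
  have a_Suc: "a n < a (Suc n)" "\<And>\<beta>'. \<beta>' \<le> a n \<Longrightarrow> h \<beta>' < a (Suc n)" for n
    using s[OF a[of n]] by (simp_all add: a_def)
  have "|range a| \<le>o |\<mu>|"
    using infinite_\<mu> by (intro card_of_image_le) (simp add: infinite_iff_card_of_nat)
  then obtain \<gamma> where \<gamma>: "\<gamma> \<in> \<kappa>" "\<forall>n. a n < \<gamma>" using bounded[of "range a"] a by auto
  \<comment> \<open>The supremum of the sequence, as least strict upper bound. It is a limit because
    the sequence increases strictly.\<close>
  define \<delta> where "\<delta> = (LEAST \<delta>. \<forall>n. a n < \<delta>)"
  have a\<delta>: "a n < \<delta>" for n
    unfolding \<delta>_def using LeastI[of "\<lambda>\<delta>. \<forall>n. a n < \<delta>" \<gamma>] \<gamma>(2) by blast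
  have "\<delta> \<le> \<gamma>" unfolding \<delta>_def using \<gamma>(2) by (intro Least_le)
  then have "\<delta> \<in> \<kappa>" using \<gamma>(1) \<kappa>_downward by blast
  have below: "\<exists>n. \<beta> \<le> a n" if "\<beta> < \<delta>" for \<beta>
    using not_less_Least[OF that[unfolded \<delta>_def]] by (auto simp: not_less)
  have "\<delta> \<noteq> ord_zero" using a\<delta>[of 0] ord_zero_le[of "a 0"] by (metis leD)
  moreover have "\<forall>\<beta><\<delta>. \<exists>\<gamma>. \<beta> < \<gamma> \<and> \<gamma> < \<delta>"
    using below a\<delta> a_Suc(1) by (meson order_le_less_trans)
  moreover have "\<forall>\<beta><\<delta>. h \<beta> < \<delta>"
    using below a\<delta> a_Suc(2) by (meson order_less_trans)
  moreover have "\<alpha> < \<delta>" using a\<delta>[of 0] by (simp add: a_def)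
  ultimately show "\<exists>\<gamma>\<in>{\<alpha>\<in>\<kappa>. limit_ord \<alpha> \<and> (\<forall>\<beta><\<alpha>. h \<beta> < \<alpha>)}. \<alpha> < \<gamma>"
    using \<open>\<delta> \<in> \<kappa>\<close> by (auto simp: limit_ord_def)
next
  fix \<delta> assume "\<delta> \<in> \<kappa>" and "limit_ord \<delta> \<and>
    (\<forall>\<beta><\<delta>. \<exists>\<gamma>\<in>{\<alpha>\<in>\<kappa>. limit_ord \<alpha> \<and> (\<forall>\<beta><\<alpha>. h \<beta> < \<alpha>)}. \<beta> < \<gamma> \<and> \<gamma> < \<delta>)"
  then show "\<delta> \<in> {\<alpha>\<in>\<kappa>. limit_ord \<alpha> \<and> (\<forall>\<beta><\<alpha>. h \<beta> < \<alpha>)}"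
    by (auto intro: order_less_trans)
qed auto

end

section \<open>The cardinals aleph_i\<close>

declare omega.simps(2) [simp del]

lemma infinite_omega:
  assumes "has_omega TYPE('o::wellorder) k" "i \<le> k"
  shows "infinite (omega i :: 'o set)"
  using assms(2)
proof (induction i)
  case 0
  then show ?case using assms(1) by (simp add: has_omega_def)
next
  case (Suc i)
  then have "|omega i :: 'o set| \<le>o |omega (Suc i) :: 'o set|"
    using assms(1) ordLess_imp_ordLeq unfolding has_omega_def by (metis Suc_le_eq)
  then show ?case using Suc card_of_ordLeq_infinite by (metis Suc_leD)
qed

lemma successor_cardinal_omega:
  assumes "has_omega TYPE('o::wellorder) k" "i < k"
  shows "successor_cardinal (omega (Suc i) :: 'o set) (omega i)"
proof
  show "infinite (omega i :: 'o set)" using infinite_omega assms by (metis less_imp_le)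
  show "|omega i :: 'o set| <o |omega (Suc i) :: 'o set|"
    using assms unfolding has_omega_def by blast
qed (simp add: omega.simps(2))

lemma card_of_omega_0: "|omega 0 :: 'o::wellorder set| \<le>o natLeq"
proof -
  have "inj_on (\<lambda>\<alpha>. card {..<\<alpha>}) (omega 0 :: 'o set)"
  proof (rule linorder_inj_onI)
    fix \<alpha> \<beta> :: 'o assume "\<alpha> < \<beta>" "\<beta> \<in> omega 0"
    then have "{..<\<alpha>} \<subset> {..<\<beta>}" "finite {..<\<beta>}" by auto
    then show "card {..<\<alpha>} \<noteq> card {..<\<beta>}" by (metis psubset_card_mono less_irrefl)
  qed auto
  then have "|omega 0 :: 'o set| \<le>o |UNIV :: nat set|" 
    unfolding card_of_ordLeq[symmetric] by blast
  then show ?thesis using card_of_nat by (rule ordLeq_ordIso_trans)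
qed

text \<open>Initial pieces of a cofinal enumeration need not be directed. Closing them under one
  fixed choice \<open>u\<close> of upper bounds repairs this without raising an infinite
  cardinality, and fixing \<open>u\<close> makes the hull monotone.\<close>

lemma directed_hull:
  fixes X :: "('w \<Rightarrow> nat) set" and B :: "'b set"
  assumes "directed_star X" "infinite B"
  obtains H where "\<And>A. A \<subseteq> X \<Longrightarrow> H A \<subseteq> X" "\<And>A. A \<subseteq> H A"
    "\<And>A. A \<subseteq> X \<Longrightarrow> A \<noteq> {} \<Longrightarrow> directed_star (H A)"
    "\<And>A A'. A \<subseteq> A' \<Longrightarrow> H A \<subseteq> H A'"
    "\<And>A. |A| \<le>o |B| \<Longrightarrow> |H A| \<le>o |B|"
proof -
  have "\<forall>f g. \<exists>h. f \<in> X \<longrightarrow> g \<in> X \<longrightarrow> h \<in> X \<and> f \<le>\<^sup>* h \<and> g \<le>\<^sup>* h"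
    using assms(1) unfolding directed_star_def by blast
  then obtain u where u: "\<And>f g. f \<in> X \<Longrightarrow> g \<in> X \<Longrightarrow> u f g \<in> X \<and> f \<le>\<^sup>* u f g \<and> g \<le>\<^sup>* u f g"
    by metis
  define s where "s S = S \<union> (\<lambda>(f, g). u f g) ` (S \<times> S)" for S
  define H where "H A = (\<Union>n. (s ^^ n) A)" for A
  have sX: "(s ^^ n) A \<subseteq> X" if "A \<subseteq> X" for n A
  proof (induction n)
    case (Suc n)
    have "s S \<subseteq> X" if "S \<subseteq> X" for S
      using that u by (auto simp: s_def)
    then show ?case using Suc by simp
  qed (simp add: that)
  have s_mono: "(s ^^ n) A \<subseteq> (s ^^ n) A'" if "A \<subseteq> A'" for n A A'
  proof (induction n)
    case (Suc n)
    have "s S \<subseteq> s S'" if "S \<subseteq> S'" for S S'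
      using that by (auto simp: s_def)
    then show ?case using Suc by simp
  qed (simp add: that)
  have s_inc: "(s ^^ m) A \<subseteq> (s ^^ n) A" if "m \<le> n" for m n A
    using that
  proof (induction rule: dec_induct)
    case (step n)
    have "S \<subseteq> s S" for S by (auto simp: s_def)
    then show ?case using step.IH by (metis order_trans funpow.simps(2) comp_apply)
  qed simp
  show ?thesis
  proof (rule that)
    show HX: "H A \<subseteq> X" if "A \<subseteq> X" for A
      using sX[OF that] by (auto simp: H_def)
    show AH: "A \<subseteq> H A" for A
      using UN_upper[of 0 UNIV "\<lambda>n. (s ^^ n) A"] by (simp add: H_def)
    show "H A \<subseteq> H A'" if "A \<subseteq> A'" for A A'
      unfolding H_def by (intro UN_mono s_mono that order_refl)
    show "directed_star (H A)" if A: "A \<subseteq> X" "A \<noteq> {}" for A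
      unfolding directed_star_def
    proof (intro conjI ballI)
      show "H A \<noteq> {}" using AH[of A] A(2) by auto
      fix f g assume "f \<in> H A" "g \<in> H A"
      then obtain m n where "f \<in> (s ^^ m) A" "g \<in> (s ^^ n) A" by (auto simp: H_def)
      then have fg: "f \<in> (s ^^ max m n) A" "g \<in> (s ^^ max m n) A"
        using s_inc[of m "max m n" A] s_inc[of n "max m n" A] by auto
      then have "u f g \<in> (s ^^ Suc (max m n)) A" by (auto simp: s_def)
      then have "u f g \<in> H A" unfolding H_def by blast
      moreover have "f \<in> X" "g \<in> X" using fg sX[OF A(1)] by auto
      ultimately show "\<exists>h\<in>H A. f \<le>\<^sup>* h \<and> g \<le>\<^sup>* h" using u by blast
    qed
    show "|H A| \<le>o |B|" if "|A| \<le>o |B|" for A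
    proof -
      have "|(s ^^ n) A| \<le>o |B|" for n
      proof (induction n)
        case (Suc n)
        then show ?case
          using assms(2) by (simp add: s_def card_of_Un_le card_of_image_le card_of_Times_le)
      qed (simp add: that)
      then show ?thesis
        unfolding H_def using assms(2)
        by (intro card_of_UNION_ordLeq_infinite) (auto simp: infinite_iff_card_of_nat)
    qed
  qed
qed

lemma cofinal_in_UN:
  assumes "\<And>i. i \<in> I \<Longrightarrow> cofinal_in le (X i) (C i)"
  shows "cofinal_in le (\<Union>i\<in>I. X i) (\<Union>i\<in>I. C i)"
  unfolding cofinal_in_def
proof (intro conjI ballI)
  show "(\<Union>i\<in>I. C i) \<subseteq> (\<Union>i\<in>I. X i)"
    using assms by (intro UN_mono) (auto simp: cofinal_in_def)
  fix x assume "x \<in> (\<Union>i\<in>I. X i)"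
  then obtain i where i: "i \<in> I" "x \<in> X i" by blast
  then obtain c where "c \<in> C i" "le x c" using assms[OF i(1)] by (auto simp: cofinal_in_def)
  then show "\<exists>c\<in>\<Union>i\<in>I. C i. le x c" using i by blast
qed

lemma directed_of_cofinal:
  assumes "directed_star C" "cofinal_in (\<le>\<^sup>*) X C"
  shows "directed_star X"
  unfolding directed_star_def
proof (intro conjI ballI)
  show "X \<noteq> {}" using assms by (auto simp: directed_star_def cofinal_in_def)
  fix f g assume "f \<in> X" "g \<in> X"
  then obtain f' g' where *: "f' \<in> C" "g' \<in> C" "f \<le>\<^sup>* f'" "g \<le>\<^sup>* g'"
    using assms(2) unfolding cofinal_in_def by blast
  then obtain h where "h \<in> C" "f' \<le>\<^sup>* h" "g' \<le>\<^sup>* h"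
    using assms(1) by (auto simp: directed_star_def)
  then show "\<exists>h\<in>X. f \<le>\<^sup>* h \<and> g \<le>\<^sup>* h"
    using * assms(2) le_star_trans[of f f' h] le_star_trans[of g g' h]
    by (auto simp: cofinal_in_def)
qed

text \<open>Each further aleph costs one degree. X is the union of a chain of directed pieces of
  cofinality at most aleph_j; \<open>vanishes_chain\<close> asks for degree p + 1 on the pieces and
  for degree p on the unions below \<gamma>, and the induction covers both.\<close>

theorem vanishes_small_cofinality:
  fixes X :: "('w \<Rightarrow> nat) set"
  assumes "has_omega TYPE('o::wellorder) j" "directed_star X" "cofinal_in (\<le>\<^sup>*) X C"
    and "|C| \<le>o |omega j :: 'o set|" "Suc j \<le> m"
  shows "vanishes X m"
  using assms
proof (induction j arbitrary: X C m)
  case 0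
  have "|C| \<le>o natLeq"
    using "0.prems"(4) card_of_omega_0 by (rule ordLeq_transitive)
  then show ?case using "0.prems" by (intro vanishes_countable[of X C m]) simp_all
next
  case (Suc j)
  interpret successor_cardinal "omega (Suc j) :: 'o set" "omega j"
    by (rule successor_cardinal_omega[OF Suc.prems(1)]) simp
  let ?\<kappa> = "omega (Suc j) :: 'o set"
  have om: "has_omega TYPE('o) j" using Suc.prems(1) by (simp add: has_omega_def)
  obtain p where p: "m = Suc p" "Suc j \<le> p" using Suc.prems(5) by (cases m) auto
  have CX: "C \<subseteq> X" using Suc.prems(3) by (simp add: cofinal_in_def)
  have "C \<noteq> {}" using Suc.prems(2,3) by (auto simp: directed_star_def cofinal_in_def)
  then obtain c where c: "c ` ?\<kappa> = C"
    using Suc.prems(4) unfolding card_of_ordLeq2[symmetric, OF \<open>C \<noteq> {}\<close>] by auto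
  obtain H where H: "\<And>A. A \<subseteq> X \<Longrightarrow> H A \<subseteq> X" "\<And>A. A \<subseteq> H A"
    "\<And>A. A \<subseteq> X \<Longrightarrow> A \<noteq> {} \<Longrightarrow> directed_star (H A)" "\<And>A A'. A \<subseteq> A' \<Longrightarrow> H A \<subseteq> H A'"
    "\<And>A. |A| \<le>o |omega j :: 'o set| \<Longrightarrow> |H A| \<le>o |omega j :: 'o set|"
    by (rule directed_hull[OF Suc.prems(2) infinite_\<mu>]) (rule that, assumption+)
  define h where "h \<gamma> = H (c ` {..\<gamma>})" for \<gamma>
  define Y where "Y \<gamma> = {f \<in> X. \<exists>g\<in>h \<gamma>. f \<le>\<^sup>* g}" for \<gamma>
  have cX: "c ` {..\<gamma>} \<subseteq> X" if "\<gamma> \<in> ?\<kappa>" for \<gamma>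
  proof -
    have "{..\<gamma>} \<subseteq> ?\<kappa>" using \<kappa>_downward[OF that] by blast
    then show ?thesis using c CX by blast
  qed
  have hX: "h \<gamma> \<subseteq> X" if "\<gamma> \<in> ?\<kappa>" for \<gamma> unfolding h_def by (rule H(1)[OF cX[OF that]])
  have hY: "cofinal_in (\<le>\<^sup>*) (Y \<gamma>) (h \<gamma>)" if "\<gamma> \<in> ?\<kappa>" for \<gamma>
  proof -
    have "g \<in> Y \<gamma>" if "g \<in> h \<gamma>" for g
      using that hX[OF \<open>\<gamma> \<in> ?\<kappa>\<close>] le_star_refl[of g] unfolding Y_def by blast
    then show ?thesis unfolding cofinal_in_def Y_def by blast
  qed
  have card_h: "|h \<gamma>| \<le>o |omega j :: 'o set|" if "\<gamma> \<in> ?\<kappa>" for \<gamma>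
    unfolding h_def by (rule H(5)[OF card_of_image_le[OF card_of_atMost[OF that]]])
  have dirY: "directed_star (Y \<gamma>)" if \<gamma>: "\<gamma> \<in> ?\<kappa>" for \<gamma>
  proof -
    have "directed_star (h \<gamma>)" unfolding h_def by (rule H(3)[OF cX[OF \<gamma>]]) auto
    then show ?thesis using hY[OF \<gamma>] by (rule directed_of_cofinal)
  qed
  have mono: "Y \<beta> \<subseteq> Y \<gamma>" if "\<beta> \<le> \<gamma>" for \<beta> \<gamma>
  proof -
    have "h \<beta> \<subseteq> h \<gamma>" unfolding h_def using that by (intro H(4) image_mono) auto
    then show ?thesis unfolding Y_def by blast
  qed
  have "vanishes (\<Union>\<gamma>\<in>?\<kappa>. Y \<gamma>) (Suc p)"
  proof (rule vanishes_chain)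
    fix \<gamma> assume \<gamma>: "\<gamma> \<in> ?\<kappa>"
    show "vanishes (Y \<gamma>) (Suc p)"
      using Suc.IH[OF om dirY[OF \<gamma>] hY[OF \<gamma>] card_h[OF \<gamma>]] p(2) by simp
    \<comment> \<open>Fewer than aleph_(j+1) pieces lie below \<gamma>, so their union has
      cofinality at most aleph_j again.\<close>
    let ?I = "{\<beta>\<in>?\<kappa>. \<beta> < \<gamma>}"
    show "vanishes (\<Union>\<beta>\<in>?I. Y \<beta>) p"
    proof (cases "?I = {}")
      case True
      show ?thesis unfolding True using vanishes_empty[of p] p(2) by simp
    next
      case False
      have "directed_star (\<Union>\<beta>\<in>?I. Y \<beta>)"
        by (rule directed_UN_chain[OF False]) (simp_all add: dirY mono)
      moreover have "cofinal_in (\<le>\<^sup>*) (\<Union>\<beta>\<in>?I. Y \<beta>) (\<Union>\<beta>\<in>?I. h \<beta>)"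
        by (rule cofinal_in_UN) (simp add: hY)
      moreover have "|\<Union>\<beta>\<in>?I. h \<beta>| \<le>o |omega j :: 'o set|"
      proof (rule card_of_UNION_ordLeq_infinite[OF infinite_\<mu>])
        show "|?I| \<le>o |omega j :: 'o set|"
          by (rule card_of_subset_le[OF card_of_lessThan[OF \<gamma>]]) auto
      qed (use card_h in auto)
      ultimately show ?thesis by (rule Suc.IH[OF om]) (rule p(2))
    qed
  qed (use mono p(2) in simp_all)
  moreover have "(\<Union>\<gamma>\<in>?\<kappa>. Y \<gamma>) = X"
  proof
    show "X \<subseteq> (\<Union>\<gamma>\<in>?\<kappa>. Y \<gamma>)"
    proof
      fix f assume f: "f \<in> X"
      then obtain \<gamma> where \<gamma>: "\<gamma> \<in> ?\<kappa>" "f \<le>\<^sup>* c \<gamma>"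
        using Suc.prems(3) unfolding cofinal_in_def c[symmetric] by blast
      have "c \<gamma> \<in> h \<gamma>" unfolding h_def by (rule subsetD[OF H(2)]) simp
      then show "f \<in> (\<Union>\<gamma>\<in>?\<kappa>. Y \<gamma>)" using f \<gamma> by (auto simp: Y_def)
    qed
  qed (auto simp: Y_def)
  ultimately show ?case by (simp add: p(1))
qed

section \<open>Twisting\<close>

text \<open>\<Psi> also has values outside Y, and there its coboundary is taken as the new family.
  This is why another trivialization of the same \<Phi> leads to another extension.\<close>

lemma extend_family:
  assumes "trivializes UNIV Y m \<Psi> \<Phi>"
  shows "\<exists>\<Phi>'. (\<forall>fs\<in>tuples Y m. \<Phi>' fs = \<Phi> fs) \<and> trivializes UNIV Z m \<Psi> \<Phi>'"
proof (intro exI conjI)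
  let ?\<Phi>' = "\<lambda>fs. if fs \<in> tuples Y m then \<Phi> fs else bd \<Psi> fs"
  show "\<forall>fs\<in>tuples Y m. ?\<Phi>' fs = \<Phi> fs" by simp
  show "trivializes UNIV Z m \<Psi> ?\<Phi>'" using assms by (simp add: trivializes_def)
qed

lemma trivializes_add_coh:
  assumes "trivializes UNIV Y (Suc j) \<Psi> \<Phi>" "coh Y j \<Theta>"
  shows "trivializes UNIV Y (Suc j) (\<lambda>fs x. \<Psi> fs x + \<Theta> fs x) \<Phi>"
  unfolding trivializes_def
proof
  fix fs assume fs: "fs \<in> tuples Y (Suc j)"
  have "eq_star_on (reg fs) (bd \<Psi> fs) (\<Phi> fs)" "eq_star_on (reg fs) (bd \<Theta> fs) (\<lambda>x. 0)"
    using assms fs by (simp_all add: trivializes_def coh_def)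
  then have "eq_star_on (reg fs) (bd (\<lambda>fs x. \<Psi> fs x + \<Theta> fs x) fs) (\<Phi> fs)"
    by (rule eq_star_on_lift2) (simp add: bd_add)
  then show "eq_star_on (reg fs \<inter> UNIV) (bd (\<lambda>fs x. \<Psi> fs x + \<Theta> fs x) fs) (\<Phi> fs)" by simp
qed

text \<open>
  Two extensions of a family that differ by \<open>\<Theta>\<close> cannot both be trivialized in a way that continues
  one and the same family below \<open>g\<close>: appending \<open>g\<close> to all tuples turns the difference of the two
  trivializations into a trivialization of \<open>\<Theta>\<close>.
\<close>

lemma twist_obstruction:
  assumes "trivializes UNIV Z (Suc j) \<Psi> \<Phi>\<^sub>0"
    and "trivializes UNIV Z (Suc j) (\<lambda>fs x. \<Psi> fs x + \<Theta> fs x) \<Phi>\<^sub>1"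
    and "trivializes E X (Suc j) \<Psi>\<^sub>0 \<Phi>\<^sub>0" "trivializes E X (Suc j) \<Psi>\<^sub>1 \<Phi>\<^sub>1" "X \<subseteq> Z"
    and "Y \<subseteq> X" "g \<in> X" "\<And>f. f \<in> Y \<Longrightarrow> f \<le>\<^sup>* g" "D \<subseteq> E" "D \<subseteq> region g"
    and agree: "\<And>fs x. fs \<in> tuples Y j \<Longrightarrow> x \<in> D \<Longrightarrow> \<Psi>\<^sub>0 fs x = \<Psi>\<^sub>1 fs x"
  shows "\<exists>\<Psi>. trivializes D Y j \<Psi> \<Theta>"
proof
  \<comment> \<open>\<open>\<Psi>\<^sub>0\<close> and \<Psi> trivialize the same family, and so do
    \<open>\<Psi>\<^sub>1\<close> and \<Psi> plus \<Theta>. Subtracting the two differences cancels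
    \<Psi> and leaves a family with vanishing coboundary.\<close>
  let ?\<Delta> = "\<lambda>fs x. \<Psi>\<^sub>1 fs x - \<Psi>\<^sub>0 fs x - \<Theta> fs x"
  let ?\<Psi> = "\<lambda>hs x. (- 1) ^ j * ?\<Delta> (hs @ [g]) x"
  show "trivializes D Y j ?\<Psi> \<Theta>"
    unfolding trivializes_def
  proof
    fix fs assume fs: "fs \<in> tuples Y j"
    then have len: "length fs = j" by (simp add: tuples_iff)
    define gs where "gs = fs @ [g]"
    have gs: "gs \<in> tuples X (Suc j)"
      unfolding gs_def using fs assms(6-8) by (intro tuples_snoc) (auto simp: tuples_iff)
    have gsZ: "gs \<in> tuples Z (Suc j)" using gs assms(5) by (rule tuples_mono)
    let ?A = "reg fs \<inter> D"
    \<comment> \<open>For j = 0 the tuple \<open>fs\<close> is empty and \<open>reg fs\<close> is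
      the whole plane; then it is \<open>D \<subseteq> region g\<close> that confines ?A to
      \<open>reg gs\<close>.\<close>
    have sub: "?A \<subseteq> reg gs \<inter> E"
      using assms(9,10) by (cases fs) (auto simp: gs_def reg_def)
    have "eq_star_on ?A (bd \<Psi> gs) (\<Phi>\<^sub>0 gs)"
      "eq_star_on ?A (bd (\<lambda>fs x. \<Psi> fs x + \<Theta> fs x) gs) (\<Phi>\<^sub>1 gs)"
      using assms(1,2) gsZ sub unfolding trivializes_def by (auto elim!: eq_star_on_subset)
    then have "eq_star_on ?A (\<lambda>x. bd \<Theta> gs x) (\<lambda>x. \<Phi>\<^sub>1 gs x - \<Phi>\<^sub>0 gs x)"
      by (rule eq_star_on_lift2) (simp add: bd_add)
    moreover have "eq_star_on ?A (bd \<Psi>\<^sub>0 gs) (\<Phi>\<^sub>0 gs)" "eq_star_on ?A (bd \<Psi>\<^sub>1 gs) (\<Phi>\<^sub>1 gs)"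
      using assms(3,4) gs sub unfolding trivializes_def by (auto elim!: eq_star_on_subset)
    then have "eq_star_on ?A (\<lambda>x. bd \<Psi>\<^sub>1 gs x - bd \<Psi>\<^sub>0 gs x) (\<lambda>x. \<Phi>\<^sub>1 gs x - \<Phi>\<^sub>0 gs x)"
      by (rule eq_star_on_lift2) simp
    ultimately have "eq_star_on ?A (bd ?\<Delta> gs) (\<lambda>x. 0)"
      by (rule eq_star_on_lift2) (simp add: bd_diff)
    then show "eq_star_on ?A (bd ?\<Psi> fs) (\<Theta> fs)"
    proof (rule eq_star_on_lift)
      fix x assume x: "x \<in> ?A" "bd ?\<Delta> gs x = 0"
      \<comment> \<open>At \<open>fs\<close> itself the two trivializations agree on D, so the face
        without \<open>g\<close> contributes just - \<Theta>.\<close>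
      have "bd (\<lambda>hs. ?\<Delta> (hs @ [g])) fs x = (- 1) ^ j * \<Theta> fs x"
        using x(2) agree[OF fs, of x] x(1) by (simp add: gs_def bd_snoc len)
      moreover have "(- 1 :: int) ^ j * ((- 1) ^ j * c) = c" for c
        by (simp add: mult.assoc[symmetric] power_mult_distrib[symmetric])
      ultimately show "bd ?\<Psi> fs x = \<Theta> fs x"
        by (simp only: bd_scale)
    qed
  qed
qed

section \<open>Cardinality of twistable sets\<close>

lemma card_of_twistable_step:
  fixes Ef :: "'o::wellorder \<Rightarrow> ('w \<times> nat) set"
  assumes "has_omega TYPE('o) (Suc j)"
    and "\<And>\<alpha>. \<alpha> \<in> {ord_zero} \<union> cof_set j \<Longrightarrow> |Ef \<alpha>| \<le>o |omega j :: 'o set|"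
  shows "|\<Union>\<alpha>\<in>{ord_zero} \<union> cof_set j. Ef \<alpha>| \<le>o |omega (Suc j) :: 'o set|"
proof -
  interpret successor_cardinal "omega (Suc j) :: 'o set" "omega j"
    by (rule successor_cardinal_omega[OF assms(1)]) simp
  show ?thesis
  proof (rule card_of_UNION_ordLeq_infinite[OF infinite_\<kappa>], rule_tac [2] ballI)
    have "|cof_set j :: 'o set| \<le>o |omega (Suc j) :: 'o set|"
      by (rule card_of_mono1) (simp add: cof_set_def)
    then show "|{ord_zero} \<union> cof_set j :: 'o set| \<le>o |omega (Suc j) :: 'o set|"
      by (intro card_of_Un_le[OF infinite_\<kappa> card_of_finite_le[OF infinite_\<kappa>]]) simp_all
    fix \<alpha> :: 'o assume "\<alpha> \<in> {ord_zero} \<union> cof_set j"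
    then show "|Ef \<alpha>| \<le>o |omega (Suc j) :: 'o set|"
      using assms(2) ordLess_imp_ordLeq[OF \<mu>_less_\<kappa>] ordLeq_transitive by blast
  qed
qed

text \<open>Keeps the data to be coded before a stage down to aleph_j many.\<close>

lemma card_of_twistable:
  fixes E :: "('w \<times> nat) set"
  assumes "has_omega TYPE('o::wellorder) j" "twistable_pair TYPE('o) j P Q E"
  shows "|E| \<le>o |omega j :: 'o set|"
  using assms
proof (induction j arbitrary: P Q E)
  case 0
  then have "|E| \<le>o natLeq" by (simp add: ordIso_imp_ordLeq)
  then show ?case
    using infinite_omega[OF "0.prems"(1), of 0] by (intro card_of_countable_le) simp_all
next
  case (Suc j)
  have om: "has_omega TYPE('o) j" using Suc.prems(1) by (simp add: has_omega_def)
  obtain Pf :: "'o \<Rightarrow> ('w \<Rightarrow> nat) set" and Q'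
    where "twistable_step j (twistable_pair TYPE('o) j) Pf Q' E"
    using Suc.prems(2) by auto
  then obtain Ef :: "'o \<Rightarrow> ('w \<times> nat) set" where
    E: "E = (\<Union>\<alpha>\<in>{ord_zero} \<union> cof_set j. Ef \<alpha>)" and
    Ef: "|Ef ord_zero| \<le>o |omega j :: 'o set|"
      "\<And>\<alpha>. \<alpha> \<in> cof_set j \<Longrightarrow> twistable_pair TYPE('o) j (Pf \<alpha>) (Q' ` {..<\<alpha>}) (Ef \<alpha>)"
    unfolding twistable_step_def by auto
  show ?case unfolding E
  proof (rule card_of_twistable_step[OF Suc.prems(1)])
    fix \<alpha> :: 'o assume "\<alpha> \<in> {ord_zero} \<union> cof_set j"
    then show "|Ef \<alpha>| \<le>o |omega j :: 'o set|"
      using Ef Suc.IH[OF om] by auto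
  qed
qed

text \<open>The filtration is a parameter and degree j a hypothesis, so that the step serves both
  the induction over pairs, where some filtration exists, and the theorem, where one is
  given.\<close>

lemma nontrivial_coherent_step:
  fixes P :: "('w \<Rightarrow> nat) set" and Pf :: "'o::wellorder \<Rightarrow> ('w \<Rightarrow> nat) set"
  assumes om: "has_omega TYPE('o) (Suc j)"
    and dia: "diamond (omega (Suc j) :: 'o set) (cof_set j)"
    and IH: "\<And>(P :: ('w \<Rightarrow> nat) set) Q E. twistable_pair TYPE('o) j P Q E \<Longrightarrow>
      \<exists>\<Theta>. coh P j \<Theta> \<and> (\<forall>\<Psi>. \<not> trivializes E Q j \<Psi> \<Theta>)"
    and dir: "directed_star P" and QP: "Q \<subseteq> P"
    and filt: "spine_filtration (omega (Suc j)) P Q Pf Q'"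
    and tw: "twistable_step j (twistable_pair TYPE('o) j) Pf Q' E"
  shows "\<exists>\<Phi>. coh P (Suc j) \<Phi> \<and> (\<forall>\<Psi>. \<not> trivializes E (Q' ` omega (Suc j)) (Suc j) \<Psi> \<Phi>)"
proof -
  interpret successor_cardinal "omega (Suc j) :: 'o set" "omega j"
    by (rule successor_cardinal_omega[OF om]) simp
  define \<kappa> where "\<kappa> = (omega (Suc j) :: 'o set)"
  define \<mu> where "\<mu> = (omega j :: 'o set)"
  define S where "S = (cof_set j :: 'o set)"
  note defs = \<kappa>_def[symmetric] \<mu>_def[symmetric] S_def[symmetric]
  have omj: "has_omega TYPE('o) j" using om by (simp add: has_omega_def)
  have S\<kappa>: "S \<subseteq> \<kappa>" by (auto simp: S_def \<kappa>_def cof_set_def)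
  have P_eq: "P = (\<Union>\<alpha>\<in>\<kappa>. Pf \<alpha>)"
    and Pf_mono: "\<And>\<alpha> \<beta>. \<beta> \<in> \<kappa> \<Longrightarrow> \<alpha> \<le> \<beta> \<Longrightarrow> Pf \<alpha> \<subseteq> Pf \<beta>"
    and Pf_limit: "\<And>\<delta>. \<delta> \<in> \<kappa> \<Longrightarrow> limit_ord \<delta> \<Longrightarrow> Pf \<delta> = (\<Union>\<alpha>\<in>{..<\<delta>}. Pf \<alpha>)"
    and Pf_cf: "\<And>\<alpha>. \<alpha> \<in> \<kappa> \<Longrightarrow> cf_less (\<le>\<^sup>*) (Pf \<alpha>) \<kappa>"
    and sp: "spine \<kappa> Q Q'"
    using filt \<kappa>_downward unfolding spine_filtration_def defs by simp_all
  have Q'P: "Q' \<alpha> \<in> P" if "\<alpha> \<in> \<kappa>" for \<alpha>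
    using sp that QP unfolding spine_def cofinal_in_def by auto
  have Q'_mono: "Q' \<alpha> \<le>\<^sup>* Q' \<beta>" if "\<alpha> < \<beta>" "\<beta> \<in> \<kappa>" for \<alpha> \<beta>
    using sp that \<kappa>_downward[OF that(2)[unfolded \<kappa>_def], of \<alpha>]
    unfolding spine_def defs by auto
  have "\<forall>\<alpha>. \<exists>C. \<alpha> \<in> \<kappa> \<longrightarrow> cofinal_in (\<le>\<^sup>*) (Pf \<alpha>) C \<and> |C| \<le>o |\<mu>|"
    using Pf_cf card_less_imp_le unfolding cf_less_def defs by blast
  then obtain C where C: "\<And>\<alpha>. \<alpha> \<in> \<kappa> \<Longrightarrow> cofinal_in (\<le>\<^sup>*) (Pf \<alpha>) (C \<alpha>)"
    "\<And>\<alpha>. \<alpha> \<in> \<kappa> \<Longrightarrow> |C \<alpha>| \<le>o |\<mu>|" by metis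
  obtain Ef :: "'o \<Rightarrow> ('w \<times> nat) set" where
    E: "E = (\<Union>\<alpha>\<in>{ord_zero} \<union> S. Ef \<alpha>)"
    and Ef_0: "|Ef ord_zero| \<le>o |\<mu>|"
    and Ef_reg: "\<And>\<alpha>. \<alpha> \<in> S \<Longrightarrow> Ef \<alpha> \<subseteq> region (Q' \<alpha>)"
    and Ef_tw: "\<And>\<alpha>. \<alpha> \<in> S \<Longrightarrow> twistable_pair TYPE('o) j (Pf \<alpha>) (Q' ` {..<\<alpha>}) (Ef \<alpha>)"
    and Ef_sup: "\<And>\<alpha>. \<alpha> \<in> S \<Longrightarrow> \<forall>\<beta><\<alpha>. \<exists>\<gamma>\<in>S. \<beta> < \<gamma> \<and> \<gamma> < \<alpha> \<Longrightarrow>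
      Ef \<alpha> \<subseteq> (\<Union>\<beta>\<in>({ord_zero} \<union> S) \<inter> {..<\<alpha>}. Ef \<beta>)"
    using tw unfolding twistable_step_def defs by (elim exE conjE) (rule that, auto)
  have Ef_card: "|Ef \<alpha>| \<le>o |\<mu>|" if "\<alpha> \<in> {ord_zero} \<union> S" for \<alpha>
    using that Ef_0 card_of_twistable[OF omj Ef_tw] unfolding defs by auto
  obtain G where G: "\<And>X. X \<subseteq> \<kappa> \<Longrightarrow> stationary_in \<kappa> {\<alpha>\<in>S. X \<inter> {..<\<alpha>} = G \<alpha>}"
    using dia unfolding diamond_def defs by auto

  \<comment> \<open>A later stage contains \<open>Q' \<beta>\<close> and upper bounds for all pairs
    from \<open>Pf \<beta>\<close>. Pairs from the small cofinal set \<open>C \<beta>\<close>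
    suffice, so regularity yields one bound.\<close>
  have "\<exists>\<gamma>. \<gamma> \<in> \<kappa> \<and> Q' \<beta> \<in> Pf \<gamma> \<and>
      (\<forall>f\<in>Pf \<beta>. \<forall>g\<in>Pf \<beta>. \<exists>h\<in>Pf \<gamma>. f \<le>\<^sup>* h \<and> g \<le>\<^sup>* h)" if \<beta>: "\<beta> \<in> \<kappa>" for \<beta>
  proof -
    have CP: "C \<beta> \<subseteq> P" using C(1)[OF \<beta>] \<beta> P_eq unfolding cofinal_in_def by blast
    have "\<forall>f g. \<exists>h. f \<in> P \<longrightarrow> g \<in> P \<longrightarrow> h \<in> P \<and> f \<le>\<^sup>* h \<and> g \<le>\<^sup>* h"
      using dir unfolding directed_star_def by blast
    then obtain u where u: "\<And>f g. f \<in> P \<Longrightarrow> g \<in> P \<Longrightarrow> u f g \<in> P \<and> f \<le>\<^sup>* u f g \<and> g \<le>\<^sup>* u f g"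
      by metis
    have "\<forall>f. \<exists>\<gamma>. f \<in> P \<longrightarrow> \<gamma> \<in> \<kappa> \<and> f \<in> Pf \<gamma>" unfolding P_eq by blast
    then obtain r where r: "\<And>f. f \<in> P \<Longrightarrow> r f \<in> \<kappa> \<and> f \<in> Pf (r f)" by metis
    define B where "B = insert (r (Q' \<beta>)) ((\<lambda>(f, g). r (u f g)) ` (C \<beta> \<times> C \<beta>))"
    have "B \<subseteq> \<kappa>" unfolding B_def using r u CP Q'P[OF \<beta>] by auto
    moreover have "|B| \<le>o |\<mu>|"
    proof -
      have inf: "infinite \<mu>" unfolding \<mu>_def by (rule infinite_\<mu>)
      have "|{r (Q' \<beta>)} \<union> (\<lambda>(f, g). r (u f g)) ` (C \<beta> \<times> C \<beta>)| \<le>o |\<mu>|"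
        using C(2)[OF \<beta>] inf
        by (simp add: card_of_Un_le card_of_image_le card_of_Times_le card_of_finite_le
            del: Un_insert_left)
      then show ?thesis by (simp add: B_def)
    qed
    ultimately obtain \<gamma> where \<gamma>: "\<gamma> \<in> \<kappa>" "\<And>\<beta>. \<beta> \<in> B \<Longrightarrow> \<beta> < \<gamma>"
      using bounded[of B] unfolding defs by auto
    have B\<gamma>: "f \<in> Pf \<gamma>" if "f \<in> P" "r f \<in> B" for f
      using r[OF that(1)] Pf_mono[OF \<gamma>(1) less_imp_le[OF \<gamma>(2)[OF that(2)]]] by auto
    have "Q' \<beta> \<in> Pf \<gamma>" using B\<gamma>[OF Q'P[OF \<beta>]] by (simp add: B_def)
    moreover have "\<exists>h\<in>Pf \<gamma>. f \<le>\<^sup>* h \<and> g \<le>\<^sup>* h" if fg: "f \<in> Pf \<beta>" "g \<in> Pf \<beta>" for f g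
    proof -
      obtain c d where cd: "c \<in> C \<beta>" "d \<in> C \<beta>" "f \<le>\<^sup>* c" "g \<le>\<^sup>* d"
        using fg C(1)[OF \<beta>] unfolding cofinal_in_def by blast
      then have "c \<in> P" "d \<in> P" using CP by auto
      note ucd = u[OF this]
      have "r (u c d) \<in> B" unfolding B_def using cd(1,2) by auto
      then have "u c d \<in> Pf \<gamma>" using B\<gamma> ucd by blast
      then show ?thesis using ucd cd(3,4) le_star_trans[of f c] le_star_trans[of g d] by blast
    qed
    ultimately show ?thesis using \<gamma>(1) by blast
  qed
  then obtain h\<^sub>1 where h\<^sub>1: "\<And>\<beta>. \<beta> \<in> \<kappa> \<Longrightarrow> h\<^sub>1 \<beta> \<in> \<kappa>" "\<And>\<beta>. \<beta> \<in> \<kappa> \<Longrightarrow> Q' \<beta> \<in> Pf (h\<^sub>1 \<beta>)"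
    "\<And>\<beta> f g. \<beta> \<in> \<kappa> \<Longrightarrow> f \<in> Pf \<beta> \<Longrightarrow> g \<in> Pf \<beta> \<Longrightarrow> \<exists>h\<in>Pf (h\<^sub>1 \<beta>). f \<le>\<^sup>* h \<and> g \<le>\<^sup>* h"
    by metis

  \<comment> \<open>S is unbounded because diamond makes it stationary, seen by guessing the empty
    set. The club consists of the closure points of the constant function with value
    \<beta>.\<close>
  have "\<exists>\<gamma>. \<gamma> \<in> S \<and> \<beta> < \<gamma>" if \<beta>: "\<beta> \<in> \<kappa>" for \<beta>
  proof -
    have "club_in \<kappa> {\<alpha>\<in>\<kappa>. limit_ord \<alpha> \<and> (\<forall>\<beta>'<\<alpha>. \<beta> < \<alpha>)}"
      unfolding \<kappa>_def by (rule club_closure_points) (use \<beta> in \<open>simp add: \<kappa>_def\<close>)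
    then obtain \<alpha> where \<alpha>: "\<alpha> \<in> S" "limit_ord \<alpha>" "\<forall>\<beta>'<\<alpha>. \<beta> < \<alpha>"
      using G[of "{}"] unfolding stationary_in_def by blast
    have "ord_zero < \<alpha>" using \<alpha>(2) by (rule limit_ord_pos)
    then show ?thesis using \<alpha> by blast
  qed
  then obtain h\<^sub>2 where h\<^sub>2: "\<And>\<beta>. \<beta> \<in> \<kappa> \<Longrightarrow> h\<^sub>2 \<beta> \<in> S" "\<And>\<beta>. \<beta> \<in> \<kappa> \<Longrightarrow> \<beta> < h\<^sub>2 \<beta>"
    by metis

  \<comment> \<open>An atom is a possible point of the graph of a j-family: a tuple from the spine,
    a point of some \<open>Ef \<gamma>\<close> and any integer value, all available by stage
    \<beta>. A family is coded by the atoms that are true of it.\<close>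
  define atoms :: "'o \<Rightarrow> (('w \<Rightarrow> nat) list \<times> ('w \<times> nat) \<times> int) set" where
    "atoms \<beta> = {fs. set fs \<subseteq> Q' ` {..\<beta>} \<and> length fs = j} \<times>
       (\<Union>\<gamma>\<in>({ord_zero} \<union> S) \<inter> {..\<beta>}. Ef \<gamma>) \<times> UNIV" for \<beta>
  have "|atoms \<beta>| \<le>o |\<mu>|" if \<beta>: "\<beta> \<in> \<kappa>" for \<beta>
  proof -
    have inf: "infinite \<mu>" unfolding \<mu>_def by (rule infinite_\<mu>)
    have le: "|{..\<beta>}| \<le>o |\<mu>|" using \<beta> card_of_atMost unfolding defs by blast
    have "|({ord_zero} \<union> S) \<inter> {..\<beta>}| \<le>o |\<mu>|" by (rule card_of_subset_le[OF le]) simp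
    then have "|\<Union>\<gamma>\<in>({ord_zero} \<union> S) \<inter> {..\<beta>}. Ef \<gamma>| \<le>o |\<mu>|"
      using Ef_card by (intro card_of_UNION_ordLeq_infinite[OF inf]) auto
    moreover have "|UNIV :: int set| \<le>o |\<mu>|"
    proof -
      have "|UNIV :: int set| \<le>o |UNIV :: nat set|"
        unfolding card_of_ordLeq[symmetric] by (intro exI[of _ int_encode]) (simp add: inj_int_encode)
      then have "|UNIV :: int set| \<le>o natLeq" using card_of_nat by (rule ordLeq_ordIso_trans)
      then show ?thesis by (rule card_of_countable_le[OF inf])
    qed
    ultimately show ?thesis
      unfolding atoms_def
      by (intro card_of_Times_le[OF inf] card_of_lists_le[OF inf] card_of_image_le le)
  qed
  then obtain e h\<^sub>3 where e: "inj_on e (\<Union>\<beta>\<in>\<kappa>. atoms \<beta>)" "e ` (\<Union>\<beta>\<in>\<kappa>. atoms \<beta>) \<subseteq> \<kappa>"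
    and h\<^sub>3: "\<And>\<beta>. \<beta> \<in> \<kappa> \<Longrightarrow> h\<^sub>3 \<beta> \<in> \<kappa>" "\<And>\<beta> a. \<beta> \<in> \<kappa> \<Longrightarrow> a \<in> atoms \<beta> \<Longrightarrow> e a < h\<^sub>3 \<beta>"
    using bounded_coding[of atoms] unfolding defs by blast
  define code where "code \<Psi> = e ` {(fs, x, z) \<in> (\<Union>\<beta>\<in>\<kappa>. atoms \<beta>). \<Psi> fs x = z}"
    for \<Psi> :: "'w family"
  have code_\<kappa>: "code \<Psi> \<subseteq> \<kappa>" for \<Psi> unfolding code_def using e(2) by blast

  \<comment> \<open>At closure points \<alpha>, the three functions make \<open>Pf \<alpha>\<close>
    directed and contain the spine below \<alpha>, make \<alpha> a limit of S, and put the codes of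
    all earlier atoms below \<alpha>.\<close>
  define h where "h \<beta> = max (h\<^sub>1 \<beta>) (max (h\<^sub>2 \<beta>) (h\<^sub>3 \<beta>))" for \<beta>
  define K where "K = {\<alpha>\<in>\<kappa>. limit_ord \<alpha> \<and> (\<forall>\<beta><\<alpha>. h \<beta> < \<alpha>)}"
  have club: "club_in \<kappa> K"
    unfolding K_def \<kappa>_def
  proof (rule club_closure_points, fold \<kappa>_def)
    show "h \<beta> \<in> \<kappa>" if "\<beta> \<in> \<kappa>" for \<beta>
      unfolding h_def using h\<^sub>1(1)[OF that] h\<^sub>2(1)[OF that] h\<^sub>3(1)[OF that] S\<kappa> by (auto simp: max_def)
  qed
  have K\<kappa>: "K \<subseteq> \<kappa>" by (auto simp: K_def)
  have below: "\<beta> \<in> \<kappa>" if "\<beta> < \<alpha>" "\<alpha> \<in> \<kappa>" for \<alpha> \<beta>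
    using that \<kappa>_downward unfolding defs by auto
  have K_Pf: "Pf \<alpha> = (\<Union>\<beta>\<in>{..<\<alpha>}. Pf \<beta>)" if "\<alpha> \<in> K" for \<alpha>
    using that Pf_limit by (auto simp: K_def)
  have K_h: "h\<^sub>1 \<beta> < \<alpha>" "h\<^sub>2 \<beta> < \<alpha>" "h\<^sub>3 \<beta> < \<alpha>" if "\<alpha> \<in> K" "\<beta> < \<alpha>" for \<alpha> \<beta>
    using that by (auto simp: K_def h_def)
  have K_zero: "ord_zero < \<alpha>" if "\<alpha> \<in> K" for \<alpha>
    using that by (auto simp: K_def intro: limit_ord_pos)
  have K_h\<^sub>1: "Pf (h\<^sub>1 \<beta>) \<subseteq> Pf \<alpha>" if "\<alpha> \<in> K" "\<beta> < \<alpha>" for \<alpha> \<beta>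
    using Pf_mono[OF subsetD[OF K\<kappa> that(1)] less_imp_le[OF K_h(1)[OF that]]] .
  have K_Q': "Q' \<beta> \<in> Pf \<alpha>" if "\<alpha> \<in> K" "\<beta> < \<alpha>" for \<alpha> \<beta>
    using h\<^sub>1(2)[OF below[OF that(2) subsetD[OF K\<kappa> that(1)]]] K_h\<^sub>1[OF that] by blast
  have K_dir: "directed_star (Pf \<alpha>)" if \<alpha>: "\<alpha> \<in> K" for \<alpha>
    unfolding directed_star_def
  proof (intro conjI ballI)
    show "Pf \<alpha> \<noteq> {}" using K_Q'[OF \<alpha> K_zero[OF \<alpha>]] by auto
    fix f g assume "f \<in> Pf \<alpha>" "g \<in> Pf \<alpha>"
    then have "{f, g} \<subseteq> (\<Union>\<beta>\<in>{..<\<alpha>}. Pf \<beta>)" using K_Pf[OF \<alpha>] by simp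
    then have "\<exists>\<beta>\<in>{..<\<alpha>}. {f, g} \<subseteq> Pf \<beta>"
    proof (rule subset_UN_chain[rotated])
      show "{..<\<alpha>} \<noteq> {}" using K_zero[OF \<alpha>] by auto
      show "Pf \<beta> \<subseteq> Pf \<gamma>" if "\<gamma> \<in> {..<\<alpha>}" "\<beta> \<le> \<gamma>" for \<beta> \<gamma>
        by (rule Pf_mono[OF below]) (use that \<alpha> K\<kappa> in auto)
    qed simp
    then obtain \<beta> where \<beta>: "\<beta> < \<alpha>" "f \<in> Pf \<beta>" "g \<in> Pf \<beta>" by auto
    have "\<beta> \<in> \<kappa>" using below[OF \<beta>(1)] \<alpha> K\<kappa> by auto
    then obtain k where "k \<in> Pf (h\<^sub>1 \<beta>)" "f \<le>\<^sup>* k" "g \<le>\<^sup>* k" using h\<^sub>1(3) \<beta>(2,3) by blast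
    then show "\<exists>k\<in>Pf \<alpha>. f \<le>\<^sup>* k \<and> g \<le>\<^sup>* k"
      using K_h\<^sub>1[OF \<alpha> \<beta>(1)] by blast
  qed
  have K_Ef: "Ef \<alpha> \<subseteq> (\<Union>\<beta>\<in>({ord_zero} \<union> S) \<inter> {..<\<alpha>}. Ef \<beta>)" if \<alpha>: "\<alpha> \<in> K" "\<alpha> \<in> S" for \<alpha>
  proof (rule Ef_sup[OF \<alpha>(2)], intro allI impI)
    fix \<beta> assume \<beta>: "\<beta> < \<alpha>"
    then have "\<beta> \<in> \<kappa>" using below \<alpha> K\<kappa> by auto
    then show "\<exists>\<gamma>\<in>S. \<beta> < \<gamma> \<and> \<gamma> < \<alpha>" using h\<^sub>2 K_h(2)[OF \<alpha>(1) \<beta>] by blast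
  qed
  \<comment> \<open>The true atom of \<Psi> at \<open>(fs, x)\<close> has its code below \<alpha>,
    so this code is shared by \<Psi>'; injectivity of \<open>e\<close> makes the atom true of
    \<Psi>' as well.\<close>
  have K_code: "\<Psi> fs x = \<Psi>' fs x"
    if \<alpha>: "\<alpha> \<in> K" and code: "code \<Psi> \<inter> {..<\<alpha>} = code \<Psi>' \<inter> {..<\<alpha>}"
      and fs: "fs \<in> tuples (Q' ` {..<\<alpha>}) j"
      and x: "x \<in> (\<Union>\<beta>\<in>({ord_zero} \<union> S) \<inter> {..<\<alpha>}. Ef \<beta>)" for \<alpha> \<Psi> \<Psi>' fs x
  proof -
    have "set fs \<subseteq> Q' ` {..<\<alpha>}" "length fs = j" using fs by (simp_all add: tuples_iff)
    moreover have "Q' ` {..<\<alpha>} \<subseteq> (\<Union>\<beta>\<in>{..<\<alpha>}. Q' ` {..\<beta>})" by blast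
    ultimately have "set fs \<subseteq> (\<Union>\<beta>\<in>{..<\<alpha>}. Q' ` {..\<beta>})" by (rule_tac order_trans)
    then have "\<exists>\<beta>\<in>{..<\<alpha>}. set fs \<subseteq> Q' ` {..\<beta>}"
      by (rule subset_UN_chain[rotated]) (use K_zero[OF \<alpha>] in \<open>auto intro!: image_mono\<close>)
    then obtain \<beta> where \<beta>: "\<beta> < \<alpha>" "set fs \<subseteq> Q' ` {..\<beta>}" by auto
    obtain \<gamma> where \<gamma>: "\<gamma> \<in> {ord_zero} \<union> S" "\<gamma> < \<alpha>" "x \<in> Ef \<gamma>" using x by blast
    define \<delta> where "\<delta> = max \<beta> \<gamma>"
    have \<delta>: "\<delta> < \<alpha>" "\<beta> \<le> \<delta>" "\<gamma> \<le> \<delta>" using \<beta>(1) \<gamma>(2) by (simp_all add: \<delta>_def)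
    then have \<delta>\<kappa>: "\<delta> \<in> \<kappa>" using below \<alpha> K\<kappa> by auto
    have at: "(fs, x, \<Psi> fs x) \<in> atoms \<delta>"
    proof -
      have "Q' ` {..\<beta>} \<subseteq> Q' ` {..\<delta>}" using \<delta>(2) by (intro image_mono) simp
      then have "set fs \<subseteq> Q' ` {..\<delta>}" using \<beta>(2) by (rule order_trans[rotated])
      moreover have "x \<in> (\<Union>\<gamma>\<in>({ord_zero} \<union> S) \<inter> {..\<delta>}. Ef \<gamma>)"
        using \<gamma>(1,3) \<delta>(3) by blast
      ultimately show ?thesis
        unfolding atoms_def using \<open>length fs = j\<close> by simp
    qed
    then have at': "(fs, x, \<Psi> fs x) \<in> (\<Union>\<beta>\<in>\<kappa>. atoms \<beta>)" using \<delta>\<kappa> by blast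
    have "e (fs, x, \<Psi> fs x) \<in> code \<Psi>"
      unfolding code_def by (rule imageI) (use at' in simp)
    moreover have "e (fs, x, \<Psi> fs x) < \<alpha>"
      using h\<^sub>3(2)[OF \<delta>\<kappa> at] K_h(3)[OF \<alpha> \<delta>(1)] by (rule order_less_trans)
    ultimately have "e (fs, x, \<Psi> fs x) \<in> code \<Psi>'" using code by blast
    then obtain a where a: "a \<in> {(fs, x, z) \<in> (\<Union>\<beta>\<in>\<kappa>. atoms \<beta>). \<Psi>' fs x = z}"
      "e (fs, x, \<Psi> fs x) = e a" unfolding code_def by blast
    have "a \<in> (\<Union>\<beta>\<in>\<kappa>. atoms \<beta>)" using a(1) by force
    with inj_onD[OF e(1) a(2) at'] have "a = (fs, x, \<Psi> fs x)" by (rule_tac sym) blast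
    then show ?thesis using a(1) by simp
  qed

  \<comment> \<open>\<open>Pf \<alpha>\<close> is only known to be directed for \<open>\<alpha>\<close> in the club \<open>K\<close>, so the recursion runs
      through the next such stage.\<close>
  define nx where "nx \<alpha> = (LEAST \<gamma>. \<gamma> \<in> K \<and> \<alpha> < \<gamma>)" for \<alpha>
  have nx: "nx \<alpha> \<in> K \<and> \<alpha> < nx \<alpha>" if \<alpha>: "\<alpha> \<in> \<kappa>" for \<alpha>
  proof -
    have "\<forall>\<alpha>\<in>\<kappa>. \<exists>\<gamma>\<in>K. \<alpha> < \<gamma>" using club by (simp add: club_in_def)
    then obtain \<gamma> where "\<gamma> \<in> K \<and> \<alpha> < \<gamma>" using \<alpha> by auto
    then show ?thesis unfolding nx_def by (rule LeastI)
  qed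
  have nx_le: "nx \<beta> \<le> \<alpha>" if "\<alpha> \<in> K" "\<beta> < \<alpha>" for \<alpha> \<beta>
    unfolding nx_def by (rule Least_le) (use that in simp)
  define D where "D \<alpha> = Pf (nx \<alpha>)" for \<alpha>
  have nx\<kappa>: "nx \<alpha> \<in> \<kappa>" if "\<alpha> \<in> \<kappa>" for \<alpha> using nx[OF that] K\<kappa> by auto
  have D_mono: "D \<beta> \<subseteq> D \<gamma>" if "\<gamma> \<in> \<kappa>" "\<beta> \<le> \<gamma>" for \<beta> \<gamma>
    unfolding D_def
  proof (rule Pf_mono[OF nx\<kappa>[OF that(1)]])
    show "nx \<beta> \<le> nx \<gamma>" using nx[OF that(1)] that(2) by (intro nx_le) auto
  qed
  have Pf_D: "Pf \<beta> \<subseteq> D \<beta>" if "\<beta> \<in> \<kappa>" for \<beta>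
    unfolding D_def using nx[OF that] nx\<kappa>[OF that] by (intro Pf_mono) auto
  have D_Q': "Q' ` {..\<alpha>} \<subseteq> D \<alpha>" if "\<alpha> \<in> \<kappa>" for \<alpha>
    unfolding D_def using K_Q' nx[OF that] by auto
  \<comment> \<open>No stage before \<alpha> overshoots \<alpha>, as \<alpha> is itself a candidate
    for the next point of K. A \<Theta> on \<open>Pf \<alpha>\<close> thus lives exactly where the
    recursion stands.\<close>
  have D_below: "(\<Union>\<beta>\<in>{\<beta>\<in>\<kappa>. \<beta> < \<alpha>}. D \<beta>) = Pf \<alpha>" if \<alpha>: "\<alpha> \<in> K" for \<alpha>
  proof
    have \<alpha>\<kappa>: "\<alpha> \<in> \<kappa>" using \<alpha> K\<kappa> by auto
    show "(\<Union>\<beta>\<in>{\<beta>\<in>\<kappa>. \<beta> < \<alpha>}. D \<beta>) \<subseteq> Pf \<alpha>"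
      unfolding D_def using Pf_mono[OF \<alpha>\<kappa> nx_le[OF \<alpha>]] by blast
    show "Pf \<alpha> \<subseteq> (\<Union>\<beta>\<in>{\<beta>\<in>\<kappa>. \<beta> < \<alpha>}. D \<beta>)"
      unfolding K_Pf[OF \<alpha>] using below[OF _ \<alpha>\<kappa>] Pf_D by blast
  qed
  \<comment> \<open>The family built before \<alpha> is trivial by this, whether \<alpha> is in K or
    not, so the recursion never gets stuck.\<close>
  have D_vanishes: "vanishes (\<Union>\<beta>\<in>{\<beta>\<in>\<kappa>. \<beta> < \<alpha>}. D \<beta>) (Suc j)" if \<alpha>: "\<alpha> \<in> \<kappa>" for \<alpha>
  proof (cases "{\<beta>\<in>\<kappa>. \<beta> < \<alpha>} = {}")
    case True
    show ?thesis unfolding True using vanishes_empty[of "Suc j"] by simp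
  next
    case False
    show ?thesis
    proof (rule vanishes_small_cofinality[OF omj])
      show "directed_star (\<Union>\<beta>\<in>{\<beta>\<in>\<kappa>. \<beta> < \<alpha>}. D \<beta>)"
      proof (rule directed_UN_chain[OF False])
        show "directed_star (D \<beta>)" if "\<beta> \<in> {\<beta>\<in>\<kappa>. \<beta> < \<alpha>}" for \<beta>
          unfolding D_def using that nx K_dir by simp
      qed (simp add: D_mono)
      show "cofinal_in (\<le>\<^sup>*) (\<Union>\<beta>\<in>{\<beta>\<in>\<kappa>. \<beta> < \<alpha>}. D \<beta>) (\<Union>\<beta>\<in>{\<beta>\<in>\<kappa>. \<beta> < \<alpha>}. C (nx \<beta>))"
        unfolding D_def by (rule cofinal_in_UN) (simp add: C(1) nx\<kappa>)
      show "|\<Union>\<beta>\<in>{\<beta>\<in>\<kappa>. \<beta> < \<alpha>}. C (nx \<beta>)| \<le>o |omega j :: 'o set|"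
        unfolding defs
      proof (rule card_of_UNION_ordLeq_infinite)
        show "infinite \<mu>" unfolding \<mu>_def by (rule infinite_\<mu>)
        have "|{..<\<alpha>}| \<le>o |\<mu>|" using \<alpha> card_of_lessThan unfolding defs by blast
        then show "|{\<beta>\<in>\<kappa>. \<beta> < \<alpha>}| \<le>o |\<mu>|" by (rule card_of_subset_le) auto
      qed (simp add: C(2) nx\<kappa>)
    qed simp
  qed

  \<comment> \<open>All families with the guessed code are refuted at once, already on the spine up
    to and including \<open>Q' \<alpha>\<close>. They may differ at tuples that contain
    \<open>Q' \<alpha>\<close>.\<close>
  define R where "R \<alpha> \<Phi> \<longleftrightarrow> coh (D \<alpha>) (Suc j) \<Phi> \<and> (\<alpha> \<in> K \<inter> S \<longrightarrow>
      (\<forall>\<Psi>. code \<Psi> \<inter> {..<\<alpha>} = G \<alpha> \<longrightarrow> \<not> trivializes E (Q' ` {..\<alpha>}) (Suc j) \<Psi> \<Phi>))" for \<alpha> \<Phi>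
  have "\<exists>\<Phi>. \<forall>\<alpha>\<in>\<kappa>. R \<alpha> \<Phi>"
  proof (rule chain_extension[where A = "\<lambda>\<alpha>. tuples (D \<alpha>) (Suc j)"])
    fix \<alpha> and \<Phi> \<Phi>' :: "'w family"
    assume \<alpha>: "\<alpha> \<in> \<kappa>" and R: "R \<alpha> \<Phi>" and eq: "\<And>fs. fs \<in> tuples (D \<alpha>) (Suc j) \<Longrightarrow> \<Phi> fs = \<Phi>' fs"
    have "trivializes E (Q' ` {..\<alpha>}) (Suc j) \<Psi> \<Phi> = trivializes E (Q' ` {..\<alpha>}) (Suc j) \<Psi> \<Phi>'" for \<Psi>
      unfolding trivializes_def using eq tuples_mono[OF _ D_Q'[OF \<alpha>]] by simp
    moreover have "coh (D \<alpha>) (Suc j) \<Phi>" using R by (simp add: R_def)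
    then have "coh (D \<alpha>) (Suc j) \<Phi>'" by (rule coh_cong) (rule eq)
    ultimately show "R \<alpha> \<Phi>'" using R by (simp add: R_def)
  next
    fix \<alpha> \<Phi> assume \<alpha>: "\<alpha> \<in> \<kappa>" and R: "\<And>\<beta>. \<beta> \<in> \<kappa> \<Longrightarrow> \<beta> < \<alpha> \<Longrightarrow> R \<beta> \<Phi>"
    define Y where "Y = (\<Union>\<beta>\<in>{\<beta>\<in>\<kappa>. \<beta> < \<alpha>}. D \<beta>)"
    have "coh Y (Suc j) \<Phi>"
      unfolding Y_def
    proof (rule coh_UN_chain)
      show "coh (D \<beta>) (Suc j) \<Phi>" if "\<beta> \<in> {\<beta>\<in>\<kappa>. \<beta> < \<alpha>}" for \<beta>
        using R[of \<beta>] that by (simp add: R_def)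
    qed (simp add: D_mono)
    then obtain \<Psi> where \<Psi>: "trivializes UNIV Y (Suc j) \<Psi> \<Phi>"
      using D_vanishes[OF \<alpha>] by (auto simp: vanishes_def Y_def)
    obtain \<Phi>\<^sub>0 where \<Phi>\<^sub>0: "\<forall>fs\<in>tuples Y (Suc j). \<Phi>\<^sub>0 fs = \<Phi> fs" "trivializes UNIV (D \<alpha>) (Suc j) \<Psi> \<Phi>\<^sub>0"
      using extend_family[OF \<Psi>] by blast
    have ext: "\<exists>\<Phi>'. R \<alpha> \<Phi>' \<and> (\<forall>\<beta>\<in>\<kappa>. \<beta> < \<alpha> \<longrightarrow> (\<forall>fs\<in>tuples (D \<beta>) (Suc j). \<Phi>' fs = \<Phi> fs))"
      if "R \<alpha> \<Phi>'" "\<forall>fs\<in>tuples Y (Suc j). \<Phi>' fs = \<Phi> fs" for \<Phi>'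
    proof (intro exI[of _ \<Phi>'] conjI that(1) ballI impI)
      fix \<beta> fs assume "\<beta> \<in> \<kappa>" "\<beta> < \<alpha>" "fs \<in> tuples (D \<beta>) (Suc j)"
      then have "fs \<in> tuples Y (Suc j)" unfolding Y_def by (elim tuples_mono) blast
      then show "\<Phi>' fs = \<Phi> fs" using that(2) by simp
    qed
    show "\<exists>\<Phi>'. R \<alpha> \<Phi>' \<and> (\<forall>\<beta>\<in>\<kappa>. \<beta> < \<alpha> \<longrightarrow> (\<forall>fs\<in>tuples (D \<beta>) (Suc j). \<Phi>' fs = \<Phi> fs))"
    proof (cases "R \<alpha> \<Phi>\<^sub>0")
      case True
      then show ?thesis using \<Phi>\<^sub>0(1) by (rule ext)
    next
      \<comment> \<open>The untwisted extension fails only through a family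
        \<open>\<Psi>\<^sub>0\<close> with the guessed code. Any \<open>\<Psi>\<^sub>1\<close> with
        this code that trivialized the twisted extension would agree with
        \<open>\<Psi>\<^sub>0\<close> below \<alpha> on \<open>Ef \<alpha>\<close>, and the two
        would trivialize \<Theta>.\<close>
      case False
      then obtain \<Psi>\<^sub>0 where KS: "\<alpha> \<in> K" "\<alpha> \<in> S" and \<Psi>\<^sub>0: "code \<Psi>\<^sub>0 \<inter> {..<\<alpha>} = G \<alpha>"
        "trivializes E (Q' ` {..\<alpha>}) (Suc j) \<Psi>\<^sub>0 \<Phi>\<^sub>0"
        using trivializes_imp_coh[OF \<Phi>\<^sub>0(2)] by (auto simp: R_def)
      have Y: "Y = Pf \<alpha>" unfolding Y_def by (rule D_below[OF KS(1)])
      obtain \<Theta> where \<Theta>: "coh (Pf \<alpha>) j \<Theta>" "\<And>\<Psi>. \<not> trivializes (Ef \<alpha>) (Q' ` {..<\<alpha>}) j \<Psi> \<Theta>"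
        using IH[OF Ef_tw[OF KS(2)]] by blast
      obtain \<Phi>\<^sub>1 where \<Phi>\<^sub>1: "\<forall>fs\<in>tuples Y (Suc j). \<Phi>\<^sub>1 fs = \<Phi> fs"
        "trivializes UNIV (D \<alpha>) (Suc j) (\<lambda>fs x. \<Psi> fs x + \<Theta> fs x) \<Phi>\<^sub>1"
        using extend_family[OF trivializes_add_coh[OF \<Psi>]] \<Theta>(1) Y by blast
      have "\<not> trivializes E (Q' ` {..\<alpha>}) (Suc j) \<Psi>\<^sub>1 \<Phi>\<^sub>1" if code: "code \<Psi>\<^sub>1 \<inter> {..<\<alpha>} = G \<alpha>" for \<Psi>\<^sub>1
      proof
        assume \<Psi>\<^sub>1: "trivializes E (Q' ` {..\<alpha>}) (Suc j) \<Psi>\<^sub>1 \<Phi>\<^sub>1"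
        have "\<exists>\<Psi>. trivializes (Ef \<alpha>) (Q' ` {..<\<alpha>}) j \<Psi> \<Theta>"
        proof (rule twist_obstruction[OF \<Phi>\<^sub>0(2) \<Phi>\<^sub>1(2) \<Psi>\<^sub>0(2) \<Psi>\<^sub>1 D_Q'[OF \<alpha>]])
          show "Q' ` {..<\<alpha>} \<subseteq> Q' ` {..\<alpha>}" by (intro image_mono) auto
          show "Q' \<alpha> \<in> Q' ` {..\<alpha>}" by simp
          show "f \<le>\<^sup>* Q' \<alpha>" if "f \<in> Q' ` {..<\<alpha>}" for f using that Q'_mono \<alpha> by auto
          show "Ef \<alpha> \<subseteq> E" unfolding E using KS(2) by blast
          show "Ef \<alpha> \<subseteq> region (Q' \<alpha>)" by (rule Ef_reg[OF KS(2)])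
          show "\<Psi>\<^sub>0 fs x = \<Psi>\<^sub>1 fs x" if "fs \<in> tuples (Q' ` {..<\<alpha>}) j" "x \<in> Ef \<alpha>" for fs x
            using \<Psi>\<^sub>0(1) code
            by (intro K_code[OF KS(1) _ that(1) subsetD[OF K_Ef[OF KS] that(2)]]) simp
        qed
        then show False using \<Theta>(2) by blast
      qed
      then have "R \<alpha> \<Phi>\<^sub>1" using trivializes_imp_coh[OF \<Phi>\<^sub>1(2)] by (simp add: R_def)
      then show ?thesis using \<Phi>\<^sub>1(1) by (rule ext)
    qed
  qed
  then obtain \<Phi> where \<Phi>: "\<And>\<alpha>. \<alpha> \<in> \<kappa> \<Longrightarrow> R \<alpha> \<Phi>" by auto
  have "P = (\<Union>\<alpha>\<in>\<kappa>. D \<alpha>)"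
  proof
    show "P \<subseteq> (\<Union>\<alpha>\<in>\<kappa>. D \<alpha>)" unfolding P_eq using Pf_D by blast
    show "(\<Union>\<alpha>\<in>\<kappa>. D \<alpha>) \<subseteq> P" unfolding P_eq D_def using nx\<kappa> by blast
  qed
  moreover have "coh (\<Union>\<alpha>\<in>\<kappa>. D \<alpha>) (Suc j) \<Phi>"
  proof (rule coh_UN_chain)
    show "coh (D \<beta>) (Suc j) \<Phi>" if "\<beta> \<in> \<kappa>" for \<beta>
      using \<Phi>[OF that] by (simp add: R_def)
  qed (simp add: D_mono)
  moreover have "\<not> trivializes E (Q' ` \<kappa>) (Suc j) \<Psi> \<Phi>" for \<Psi>
  proof
    assume \<Psi>: "trivializes E (Q' ` \<kappa>) (Suc j) \<Psi> \<Phi>"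
    obtain \<alpha> where \<alpha>: "\<alpha> \<in> K" "\<alpha> \<in> S" "code \<Psi> \<inter> {..<\<alpha>} = G \<alpha>"
      using G[OF code_\<kappa>, of \<Psi>] club unfolding stationary_in_def by blast
    have \<alpha>\<kappa>: "\<alpha> \<in> \<kappa>" using \<alpha>(1) K\<kappa> by auto
    have "{..\<alpha>} \<subseteq> \<kappa>" using \<alpha>\<kappa> below by (auto simp: le_less)
    then have "trivializes E (Q' ` {..\<alpha>}) (Suc j) \<Psi> \<Phi>"
      by (intro trivializes_subset[OF \<Psi>] image_mono) simp_all
    then show False using \<Phi>[OF \<alpha>\<kappa>] \<alpha> by (simp add: R_def)
  qed
  ultimately show ?thesis unfolding defs by metis
qed

lemma nontrivial_coherent:
  fixes P :: "('w \<Rightarrow> nat) set"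
  assumes "has_omega TYPE('o::wellorder) j"
    and "\<forall>i<j. diamond (omega (Suc i) :: 'o set) (cof_set i)"
    and "twistable_pair TYPE('o) j P Q E"
  shows "\<exists>\<Theta>. coh P j \<Theta> \<and> (\<forall>\<Psi>. \<not> trivializes E Q j \<Psi> \<Theta>)"
  using assms
proof (induction j arbitrary: P Q E)
  case 0
  \<comment> \<open>A 0-family is its value at the empty tuple. The indicator of E is coherent as E
    meets each region in a finite set, and nontrivial as E is infinite.\<close>
  let ?\<Theta> = "\<lambda>_ x. if x \<in> E then 1 else 0 :: int"
  have fin: "\<forall>f\<in>P. finite (E \<inter> region f)" and "|E| =o natLeq" using "0.prems"(3) by auto
  have "coh P 0 ?\<Theta>"
    unfolding coh_def
  proof
    fix fs assume "fs \<in> tuples P (Suc 0)"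
    then obtain f where f: "fs = [f]" "f \<in> P" by (auto simp: tuples_iff length_Suc_conv)
    have "{x \<in> reg fs. bd ?\<Theta> fs x \<noteq> 0} \<subseteq> E \<inter> region f"
      by (auto simp: f(1) reg_def bd_Cons split: if_splits)
    then show "eq_star_on (reg fs) (bd ?\<Theta> fs) (\<lambda>x. 0)"
      unfolding eq_star_on_def using fin f(2) finite_subset by blast
  qed
  moreover have "\<not> trivializes E Q 0 \<Psi> ?\<Theta>" for \<Psi>
  proof -
    have "natLeq \<le>o |E|" using \<open>|E| =o natLeq\<close> ordIso_iff_ordLeq by blast
    then have "infinite E" using infinite_iff_natLeq_ordLeq[of E] by simp
    then show ?thesis
      by (simp add: trivializes_def tuples_iff eq_star_on_def reg_def)
  qed
  ultimately show ?case by blast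
next
  case (Suc j)
  have om: "has_omega TYPE('o) j" using Suc.prems(1) by (simp add: has_omega_def)
  have IH: "\<exists>\<Theta>. coh P j \<Theta> \<and> (\<forall>\<Psi>. \<not> trivializes E Q j \<Psi> \<Theta>)"
    if "twistable_pair TYPE('o) j P Q E" for P Q and E :: "('w \<times> nat) set"
    using Suc.IH[OF om _ that] Suc.prems(2) by simp
  obtain Pf :: "'o \<Rightarrow> ('w \<Rightarrow> nat) set" and Q' where
    pair: "strong_unbounded_pair (omega (Suc j) :: 'o set) P Q"
    and filt: "spine_filtration (omega (Suc j)) P Q Pf Q'"
    and tw: "twistable_step j (twistable_pair TYPE('o) j) Pf Q' E"
    using Suc.prems(3) by auto
  have dir: "directed_star P" "Q \<subseteq> P"
    using pair by (simp_all add: strong_unbounded_pair_def unbounded_pair_def)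
  have "diamond (omega (Suc j) :: 'o set) (cof_set j)" using Suc.prems(2) by simp
  then obtain \<Phi> where \<Phi>: "coh P (Suc j) \<Phi>"
    "\<And>\<Psi>. \<not> trivializes E (Q' ` omega (Suc j)) (Suc j) \<Psi> \<Phi>"
    using nontrivial_coherent_step[OF Suc.prems(1) _ IH dir filt tw] by blast
  \<comment> \<open>Nontriviality on the spine is the stronger statement and passes up to Q, the
    form that the next degree consumes.\<close>
  have "Q' ` omega (Suc j) \<subseteq> Q"
    using filt by (simp add: spine_filtration_def spine_def cofinal_in_def)
  then have "\<not> trivializes E Q (Suc j) \<Psi> \<Phi>" for \<Psi>
    using \<Phi>(2) trivializes_subset[of E Q "Suc j" \<Psi> \<Phi> "Q' ` omega (Suc j)" E] by auto
  then show ?case using \<Phi>(1) by blast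
qed

theorem theorem6p4:
  fixes n k :: nat
  assumes "has_omega TYPE('w::wellorder) n" and "(UNIV :: 'w set) = omega n"
    and "has_omega TYPE('o::wellorder) k"
    and "k \<ge> 1"
    and "\<forall>i<k. diamond (omega (Suc i) :: 'o set) (cof_set i)"
  shows "\<forall>(P :: ('w \<Rightarrow> nat) set) Q (Pf :: 'o \<Rightarrow> ('w \<Rightarrow> nat) set) Q' E.
           strong_unbounded_pair (omega k :: 'o set) P Q \<and>
           spine_filtration (omega k) P Q Pf Q' \<and>
           twistable k Pf Q' E \<longrightarrow>
           (\<exists>\<Phi> :: 'w family. coherent UNIV P k \<Phi> \<and> \<not> trivial E (Q' ` omega k) k \<Phi>)"
proof (intro allI impI, elim conjE)
  fix P Q :: "('w \<Rightarrow> nat) set" and Pf :: "'o \<Rightarrow> ('w \<Rightarrow> nat) set" and Q' E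
  assume pair: "strong_unbounded_pair (omega k :: 'o set) P Q"
    and filt: "spine_filtration (omega k) P Q Pf Q'" and tw: "twistable k Pf Q' E"
  obtain j where k: "k = Suc j" using assms(4) by (cases k) auto
  have om: "has_omega TYPE('o) j" using assms(3) by (simp add: has_omega_def k)
  \<comment> \<open>Only degree j comes from the induction over pairs; in degree k the step is
    applied to the given filtration itself.\<close>
  have IH: "\<exists>\<Theta>. coh P j \<Theta> \<and> (\<forall>\<Psi>. \<not> trivializes E Q j \<Psi> \<Theta>)"
    if "twistable_pair TYPE('o) j P Q E" for P Q and E :: "('w \<times> nat) set"
    using nontrivial_coherent[OF om _ that] assms(5) by (simp add: k)
  have dir: "directed_star P" "Q \<subseteq> P"
    using pair by (simp_all add: strong_unbounded_pair_def unbounded_pair_def)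
  have "diamond (omega (Suc j) :: 'o set) (cof_set j)" using assms(5) by (simp add: k)
  moreover have "twistable_step j (twistable_pair TYPE('o) j) Pf Q' E"
    using tw by (simp add: twistable_def k)
  ultimately obtain \<Phi> where \<Phi>: "coh P k \<Phi>" "\<And>\<Psi>. \<not> trivializes E (Q' ` omega k) k \<Psi> \<Phi>"
    using nontrivial_coherent_step[OF assms(3)[unfolded k] _ IH dir filt[unfolded k]]
    unfolding k by blast
  have "coherent UNIV P k \<Phi>" using \<Phi>(1) assms(4) by (rule coh_imp_coherent)
  moreover have "\<not> trivial E (Q' ` omega k) k \<Phi>"
    using trivial_imp_trivializes assms(4) \<Phi>(2) by blast
  ultimately show "\<exists>\<Phi>. coherent UNIV P k \<Phi> \<and> \<not> trivial E (Q' ` omega k) k \<Phi>" by blast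
qed

end
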